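(* Let $\Sigma$ be a finite set of states with $|\Sigma|\ge 2$, let $A\colon\mathbb{N}_0^{\Sigma}\to\Sigma$ be a tree automaton, and let $\chi$ be a child distribution (a probability measure on $\{0,1,2,\ldots\}$ with $\chi(\{2,3,\ldots\})>0$). Let $\Psi$ be the automaton distributional map corresponding to $A$ and $\chi$, and let $\vec\nu$ be a fixed point of $\Psi$ all of whose entries are nonzero. If the pivot tree with maximal target set associated with $\vec\nu$ is subcritical, then $\vec\nu$ admits an interpretation (i.e. there exists an interpretation of $A$ under $\mathrm{GW}(\chi)$ corresponding to $\vec\nu$).
   Context: Trees. $\mathcal{T}$ is the set of locally finite, ordered, rooted trees, with the Borel $\sigma$-algebra of the local topology (generated by the sets of all trees agreeing with a given tree up to generation $n$). For $t\in\mathcal{T}$, $V(t)$ is the vertex set, $R_t$ the root, $t(v)$ the subtree formed by $v$ and its descendants, $t|_n$ the truncation of $t$ to generations $0,\dots,n$ (the root is generation $0$), $L_n(t)$ the set of vertices in generation $n$. $\mathrm{GW}(\chi)$ is the law on $\mathcal{T}$ of the Galton--Watson tree with child distribution $\chi$. Automata and interpretations. A tree automaton on a finite set $\Sigma$ is a map $A\colon\mathbb{N}_0^\Sigma\to\Sigma$; $A(\vec n)$ is the state of a parent having $n_\sigma$ children in state $\sigma$ for each $\sigma$. A colouring $\tau\colon V(t)\to\Sigma$ is compatible with $A$ if for every $v\in V(t)$, $\tau(v)=A(\vec n)$, where $n_\sigma$ is the number of children of $v$ with colour $\sigma$. A measurable map $\iota\colon\mathcal{T}\to\Sigma$ is an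 interpretation of $A$ under $\mathrm{GW}(\chi)$ if for $\mathrm{GW}(\chi)$-a.e. $t$ the colouring $v\mapsto\iota(t(v))$ is compatible with $A$. Let $D$ be the set of probability distributions on $\Sigma$. The automaton distributional map $\Psi\colon D\to D$ sends $\vec x$ to the law of the state $A$ assigns to a parent having a $\chi$-distributed number of children whose states are i.i.d. with law $\vec x$. If $\vec\nu$ is a fixed point of $\Psi$, an interpretation $\iota$ corresponds to $\vec\nu$ if $\iota(T)\sim\vec\nu$ when $T\sim\mathrm{GW}(\chi)$. Random state tree. For a fixed point $\vec\nu$, the random state tree $(T,\omega)$ is a random tree $T$ with a random colouring $\omega\colon V(T)\to\Sigma$ whose law is uniquely determined by: (i) $T\sim\mathrm{GW}(\chi)$; (ii) for every $n$, conditionally on $T|_n$, $(\omega(v))_{v\in L_n(T)}$ is i.i.d. with law $\vec\nu$; (iii) $\omega$ is a.s. compatible with $A$. Pivot tree with maximal target set. For $(t,\tau)$ with $\tau$ compatible with $A$, $v\in L_n(t)$ and $\gamma\in\Sigma$, let $\tau^{v\to\gamma}$ be the colouring of $t|_n$ obtained by changing the colour of $v$ to $\gamma$, keeping the other colours in generation $n$, and recomputing the colours in generations $n-1,\dots,0$ with $A$. For $v\in V(T)$ let $B_v=\{\gamma\in\Sigma:\omega^{v\to\gamma}(R_T)\ne\omega(R_T)\}$. The vertex $v$ is pivotal if $B_v\ne\emptyset$, and the pivot tree with maximal target set, $T_{\mathrm{piv}}$, is the subtree of $T$ induced by the pivotal vertices. Assigning type $(\omega(v);B_v)$ to each vertex,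 $T_{\mathrm{piv}}$ is a multitype Galton--Watson tree. Its matrix of means, indexed by the types that occur with positive probability in $T_{\mathrm{piv}}$, has $(i,j)$ entry equal to the expected number of type-$j$ children in $T_{\mathrm{piv}}$ of a vertex of type $i$. $T_{\mathrm{piv}}$ is subcritical if this matrix has spectral radius less than $1$ (if some entry is infinite, the spectral radius is taken to be $\infty$). *)

theory Defs
  imports "HOL-Probability.Probability" "Jordan_Normal_Form.Spectral_Radius"
begin

section \<open>Locally finite ordered rooted trees\<close>

codatatype tree = Node (children: "tree list")

text \<open>Vertices are addressed by the list of child indices on the path from the root (so the root is
  \<open>[]\<close>, and the children of \<open>v\<close> are \<open>v @ [i]\<close>). The function \<open>subtree\<close> is meaningful
  only at addresses that belong to \<open>vertices t\<close>.\<close>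

fun is_vertex :: "tree \<Rightarrow> nat list \<Rightarrow> bool" where
  "is_vertex t [] \<longleftrightarrow> True"
| "is_vertex t (i # v) \<longleftrightarrow> i < length (children t) \<and> is_vertex (children t ! i) v"

definition vertices :: "tree \<Rightarrow> nat list set" where
  "vertices t = {v. is_vertex t v}"

definition generation :: "nat \<Rightarrow> tree \<Rightarrow> nat list set" where
  "generation n t = {v \<in> vertices t. length v = n}"

fun subtree :: "tree \<Rightarrow> nat list \<Rightarrow> tree" where
  "subtree t [] = t"
| "subtree t (i # v) = subtree (children t ! i) v"

definition num_children :: "tree \<Rightarrow> nat list \<Rightarrow> nat" where
  "num_children t v = length (children (subtree t v))"

primrec truncate_tree :: "nat \<Rightarrow> tree \<Rightarrow> tree" where
  "truncate_tree 0 t = Node []"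
| "truncate_tree (Suc n) t = Node (map (truncate_tree n) (children t))"

definition tree_space :: "tree measure" where
  "tree_space = sigma UNIV {{t'. truncate_tree n t' = truncate_tree n t} | n t. True}"


section \<open>Galton--Watson trees\<close>

primcorec tree_of_counts :: "(nat list \<Rightarrow> nat) \<Rightarrow> tree" where
  "children (tree_of_counts k) = map (\<lambda>i. tree_of_counts (\<lambda>v. k (i # v))) [0..<k []]"

text \<open>Every address carries an independent \<open>chi\<close>-distributed number of children; the numbers at
  addresses outside of the resulting tree are ignored.\<close>

definition GW :: "nat pmf \<Rightarrow> tree measure" where
  "GW chi = distr (PiM UNIV (\<lambda>_. measure_pmf chi)) tree_space tree_of_counts"


section \<open>Automata and interpretations\<close>

type_synonym 's automaton = "('s \<Rightarrow> nat) \<Rightarrow> 's"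

text \<open>Colourings are total functions on addresses; only their values on \<open>vertices t\<close> matter.\<close>

definition parent_state :: "'s automaton \<Rightarrow> tree \<Rightarrow> (nat list \<Rightarrow> 's) \<Rightarrow> nat list \<Rightarrow> 's" where
  "parent_state A t \<tau> v = A (\<lambda>\<sigma>. card {i. i < num_children t v \<and> \<tau> (v @ [i]) = \<sigma>})"

definition compatible :: "'s automaton \<Rightarrow> tree \<Rightarrow> (nat list \<Rightarrow> 's) \<Rightarrow> bool" where
  "compatible A t \<tau> \<longleftrightarrow> (\<forall>v\<in>vertices t. \<tau> v = parent_state A t \<tau> v)"

definition interpretation_of :: "'s automaton \<Rightarrow> nat pmf \<Rightarrow> (tree \<Rightarrow> 's) \<Rightarrow> bool" where
  "interpretation_of A chi \<iota> \<longleftrightarrow>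
     \<iota> \<in> tree_space \<rightarrow>\<^sub>M count_space UNIV \<and>
     (AE t in GW chi. compatible A t (\<lambda>v. \<iota> (subtree t v)))"

definition distributional_map :: "'s automaton \<Rightarrow> nat pmf \<Rightarrow> 's pmf \<Rightarrow> 's pmf" where
  "distributional_map A chi x =
     bind_pmf chi (\<lambda>k. map_pmf (\<lambda>states. A (count_list states)) (replicate_pmf k x))"

definition corresponds_to :: "nat pmf \<Rightarrow> (tree \<Rightarrow> 's) \<Rightarrow> 's pmf \<Rightarrow> bool" where
  "corresponds_to chi \<iota> \<nu> \<longleftrightarrow> distr (GW chi) (count_space UNIV) \<iota> = measure_pmf \<nu>"


section \<open>The random state tree\<close>

text \<open>The pair \<open>(T, \<omega>)\<close> is defined on the probability space \<open>M\<close>. There are only countably many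
  trees \<open>s\<close> of height at most \<open>n\<close>, so the conditional law given the truncation of \<open>T\<close> at \<open>n\<close> is
  expressed by elementary conditioning on \<open>truncate_tree n T = s\<close>. The defining properties determine
  the joint law of \<open>T\<close> and the restriction of \<open>\<omega>\<close> to \<open>vertices T\<close>.\<close>

definition random_state_tree ::
  "'s automaton \<Rightarrow> nat pmf \<Rightarrow> 's pmf \<Rightarrow> 'b measure \<Rightarrow> ('b \<Rightarrow> tree) \<Rightarrow> ('b \<Rightarrow> nat list \<Rightarrow> 's) \<Rightarrow> bool"
where
  "random_state_tree A chi \<nu> M T \<omega> \<longleftrightarrow>
     prob_space M \<and>
     T \<in> M \<rightarrow>\<^sub>M tree_space \<and>
     (\<forall>v \<sigma>. {x \<in> space M. v \<in> vertices (T x) \<and> \<omega> x v = \<sigma>} \<in> sets M) \<and>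
     distr M tree_space T = GW chi \<and>
     (\<forall>n s c. \<P>(x in M. truncate_tree n (T x) = s \<and> (\<forall>v\<in>generation n s. \<omega> x v = c v)) =
        \<P>(x in M. truncate_tree n (T x) = s) * (\<Prod>v\<in>generation n s. pmf \<nu> (c v))) \<and>
     (AE x in M. compatible A (T x) (\<omega> x))"


section \<open>The pivot tree with maximal target set\<close>

text \<open>The colour of \<open>u\<close> computed by \<open>A\<close> from the colours \<open>c\<close> of its descendants \<open>d\<close> generations
  below (and from the leaves in between).\<close>

primrec recompute :: "'s automaton \<Rightarrow> tree \<Rightarrow> (nat list \<Rightarrow> 's) \<Rightarrow> nat \<Rightarrow> nat list \<Rightarrow> 's" where
  "recompute A t c 0 = c"
| "recompute A t c (Suc d) = parent_state A t (recompute A t c d)"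

definition recolour :: "'s automaton \<Rightarrow> tree \<Rightarrow> (nat list \<Rightarrow> 's) \<Rightarrow> nat list \<Rightarrow> 's \<Rightarrow> nat list \<Rightarrow> 's" where
  "recolour A t \<tau> v \<gamma> u = recompute A t (\<tau>(v := \<gamma>)) (length v - length u) u"

definition target_set :: "'s automaton \<Rightarrow> tree \<Rightarrow> (nat list \<Rightarrow> 's) \<Rightarrow> nat list \<Rightarrow> 's set" where
  "target_set A t \<tau> v = {\<gamma>. recolour A t \<tau> v \<gamma> [] \<noteq> \<tau> []}"

definition pivot_tree :: "'s automaton \<Rightarrow> tree \<Rightarrow> (nat list \<Rightarrow> 's) \<Rightarrow> nat list set" where
  "pivot_tree A t \<tau> = {v \<in> vertices t. target_set A t \<tau> v \<noteq> {}}"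

type_synonym 's pivot_type = "'s \<times> 's set"

definition pivot_of_type ::
  "'s automaton \<Rightarrow> tree \<Rightarrow> (nat list \<Rightarrow> 's) \<Rightarrow> nat list \<Rightarrow> 's pivot_type \<Rightarrow> bool" where
  "pivot_of_type A t \<tau> v i \<longleftrightarrow> v \<in> pivot_tree A t \<tau> \<and> (\<tau> v, target_set A t \<tau> v) = i"

definition occurring_types ::
  "'s automaton \<Rightarrow> 'b measure \<Rightarrow> ('b \<Rightarrow> tree) \<Rightarrow> ('b \<Rightarrow> nat list \<Rightarrow> 's) \<Rightarrow> 's pivot_type set" where
  "occurring_types A M T \<omega> = {i. \<P>(x in M. \<exists>v. pivot_of_type A (T x) (\<omega> x) v i) > 0}"

text \<open>The conditional expectation, given that \<open>v\<close> is a type-\<open>i\<close> vertex of the pivot tree, of the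
  number of its type-\<open>j\<close> children in the pivot tree.\<close>

definition mean_children_at ::
  "'s automaton \<Rightarrow> 'b measure \<Rightarrow> ('b \<Rightarrow> tree) \<Rightarrow> ('b \<Rightarrow> nat list \<Rightarrow> 's) \<Rightarrow>
   nat list \<Rightarrow> 's pivot_type \<Rightarrow> 's pivot_type \<Rightarrow> ennreal" where
  "mean_children_at A M T \<omega> v i j =
     (\<integral>\<^sup>+x. of_nat (card {k. pivot_of_type A (T x) (\<omega> x) (v @ [k]) j}) *
           indicator {x. pivot_of_type A (T x) (\<omega> x) v i} x \<partial>M) /
     ennreal \<P>(x in M. pivot_of_type A (T x) (\<omega> x) v i)"

text \<open>As the pivot tree is a multitype Galton--Watson tree, the choice of the vertex \<open>v\<close> at which
  type \<open>i\<close> occurs with positive probability is irrelevant.\<close>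

definition mean_children ::
  "'s automaton \<Rightarrow> 'b measure \<Rightarrow> ('b \<Rightarrow> tree) \<Rightarrow> ('b \<Rightarrow> nat list \<Rightarrow> 's) \<Rightarrow>
   's pivot_type \<Rightarrow> 's pivot_type \<Rightarrow> ennreal" where
  "mean_children A M T \<omega> i j =
     mean_children_at A M T \<omega> (SOME v. \<P>(x in M. pivot_of_type A (T x) (\<omega> x) v i) > 0) i j"

text \<open>The spectral radius of a nonnegative matrix with rows and columns indexed by a finite set \<open>I\<close>;
  it does not depend on the enumeration of \<open>I\<close>.\<close>

definition spectral_radius_on :: "'i set \<Rightarrow> ('i \<Rightarrow> 'i \<Rightarrow> ennreal) \<Rightarrow> ennreal" where
  "spectral_radius_on I m =
     (if \<exists>i\<in>I. \<exists>j\<in>I. m i j = \<infinity> then \<infinity>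
      else let is = (SOME is. distinct is \<and> set is = I) in
        ennreal (spectral_radius (Matrix.mat (length is) (length is)
          (\<lambda>(a, b). complex_of_real (enn2real (m (is ! a) (is ! b)))))))"

definition pivot_tree_subcritical ::
  "'s automaton \<Rightarrow> 'b measure \<Rightarrow> ('b \<Rightarrow> tree) \<Rightarrow> ('b \<Rightarrow> nat list \<Rightarrow> 's) \<Rightarrow> bool" where
  "pivot_tree_subcritical A M T \<omega> \<longleftrightarrow>
     spectral_radius_on (occurring_types A M T \<omega>) (mean_children A M T \<omega>) < 1"

end

theory Submission
  imports Defs
begin

text \<open>
  Let \<open>q\<^sub>n(t)\<close> be the law of the root state of \<open>t\<close> when the states in generation \<open>n\<close> are
  i.i.d. with law \<open>\<nu>\<close>, that is, the law of \<open>\<omega>(R)\<close> given the truncation of \<open>T\<close> at \<open>n\<close>, and let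
  \<open>V\<^sub>n(B)\<close> be the expected conditional variance of the indicator of \<open>\<omega>(R) \<in> B\<close>. By the Efron--Stein
  inequality, applied to the children of the root, \<open>V\<^sub>n\<^sub>+\<^sub>1(B)\<close> is at most the sum over \<open>C\<close> of \<open>V\<^sub>n(C)\<close>
  times the mean number of children whose change of state to \<open>\<gamma>\<close> moves the root state into \<open>B\<close>
  exactly for \<open>\<gamma> \<in> C\<close>. Up to weights given by \<open>\<nu>\<close>, these numbers are entries of the matrix of means of
  the pivot tree, so subcriticality makes \<open>V\<^sub>n\<close> decay geometrically. Then the mean square distances
  between \<open>q\<^sub>n(T)\<close> and the point mass at \<open>\<omega>(R)\<close> are summable, hence \<open>q\<^sub>n(T)\<close> converges almost surely to that point
  mass, and \<open>\<iota>(t)\<close> is the state at which \<open>lim q\<^sub>n(t)\<close> sits. If the limits at all children of a vertex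
  are point masses, then so is the limit at the vertex, and their positions are compatible with \<open>A\<close>.
\<close>

section \<open>Random lists with independent entries\<close>

text \<open>The recursion for the variances is indexed by sets, the matrix of means by pairs of a
  state and a set, and only by pairs that occur. The bridge is to follow, for a set
  \<open>B\<close>, all types \<open>(a, B)\<close> with \<open>a \<notin> B\<close> at once, with
  weights \<open>pmf \<nu> a\<close>. Summed over these \<open>a\<close>, the weighted means towards
  \<open>(c, C)\<close> give the coefficient of \<open>mean_var n C\<close> times
  \<open>pmf \<nu> c\<close>, so the same weights reappear one generation later. The family stays
  inside the index set because every state has positive mass: a nonzero coefficient from
  \<open>B\<close> to a nonempty \<open>C\<close> makes every \<open>(c, C)\<close> with
  \<open>c \<notin> C\<close> occur, and the empty set has variance zero. The start is
  \<open>- {a}\<close>, the target set of a root in state \<open>a\<close>, whose variance is that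
  of \<open>{a}\<close>. The means are defined by conditioning on \<open>M\<close> at an arbitrary
  vertex, while all recursions decompose at the root. Both are read on the countable type of finite
  coloured trees, where laws are given by point masses and no conditional expectation on
  \<open>tree_space\<close> has to be formed.\<close>

fun seq_pmf :: "'a pmf list \<Rightarrow> 'a list pmf" where
  "seq_pmf [] = return_pmf []"
| "seq_pmf (p # ps) = bind_pmf p (\<lambda>x. map_pmf ((#) x) (seq_pmf ps))"

lemma seq_pmf_replicate: "seq_pmf (replicate n p) = replicate_pmf n p"
  by (induction n) (auto simp: map_pmf_def)

lemma length_seq_pmf: "xs \<in> set_pmf (seq_pmf ps) \<Longrightarrow> length xs = length ps"
  by (induction ps arbitrary: xs) auto

lemma length_replicate_pmf: "xs \<in> set_pmf (replicate_pmf n p) \<Longrightarrow> length xs = n"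
  by (auto simp: set_replicate_pmf)

text \<open>The entries are independent, so overwriting entry \<open>i\<close> by a fresh draw
  erases its old law and leaves the joint law of the others alone.\<close>

lemma seq_pmf_update:
  assumes "i < length ps"
  shows "seq_pmf (ps[i := p]) = bind_pmf (seq_pmf ps) (\<lambda>xs. map_pmf (\<lambda>x. xs[i := x]) p)"
  using assms
proof (induction ps arbitrary: i)
  case (Cons q ps)
  show ?case
  proof (cases i)
    case 0
    have "seq_pmf ((q # ps)[i := p]) = bind_pmf (seq_pmf ps) (\<lambda>xs. bind_pmf p (\<lambda>x. return_pmf (x # xs)))"
      using 0 by (simp add: map_pmf_def) (rule bind_commute_pmf)
    then show ?thesis
      using 0 by (simp add: map_pmf_def bind_assoc_pmf bind_return_pmf bind_return_pmf')
  next
    case (Suc j)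
    with Cons show ?thesis
      by (simp add: map_pmf_def bind_assoc_pmf bind_return_pmf)
  qed
qed simp

text \<open>The device for singling out one child: an integral over the list becomes an integral
  over the list and an independent new entry \<open>i\<close>.\<close>

lemma replicate_pmf_resample:
  assumes "i < n"
  shows "replicate_pmf n p = bind_pmf (replicate_pmf n p) (\<lambda>xs. map_pmf (\<lambda>x. xs[i := x]) p)"
proof -
  have "(replicate n p)[i := p] = replicate n p"
    using assms by (metis list_update_id nth_replicate)
  with seq_pmf_update[of i "replicate n p" p] assms show ?thesis
    by (simp add: seq_pmf_replicate)
qed

text \<open>Passes from states that are independent given the subtrees, with laws \<open>f x\<close>
  varying from child to child, to states that are i.i.d. after averaging over the subtrees.\<close>

lemma bind_replicate_pmf_seq:
  "bind_pmf (replicate_pmf n p) (\<lambda>xs. seq_pmf (map f xs)) = replicate_pmf n (bind_pmf p f)"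
proof (induction n)
  case (Suc n)
  have "bind_pmf (replicate_pmf (Suc n) p) (\<lambda>xs. seq_pmf (map f xs))
      = bind_pmf p (\<lambda>x. bind_pmf (replicate_pmf n p) (\<lambda>xs. bind_pmf (f x) (\<lambda>y. map_pmf ((#) y) (seq_pmf (map f xs)))))"
    by (simp add: bind_assoc_pmf bind_return_pmf)
  also have "\<dots> = bind_pmf p (\<lambda>x. bind_pmf (f x) (\<lambda>y. map_pmf ((#) y) (bind_pmf (replicate_pmf n p) (\<lambda>xs. seq_pmf (map f xs)))))"
    by (subst bind_commute_pmf) (simp add: map_bind_pmf)
  finally show ?case
    by (simp add: Suc map_pmf_def bind_assoc_pmf bind_return_pmf)
qed (simp add: bind_return_pmf)

lemma map_replicate_pmf: "map_pmf (map f) (replicate_pmf n p) = replicate_pmf n (map_pmf f p)"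
proof (induction n)
  case (Suc n)
  have "map_pmf (map f) (replicate_pmf (Suc n) p)
      = bind_pmf p (\<lambda>x. map_pmf ((#) (f x)) (map_pmf (map f) (replicate_pmf n p)))"
    by (simp add: map_pmf_def bind_assoc_pmf bind_return_pmf)
  then show ?case
    by (simp only: Suc.IH) (simp add: map_pmf_def bind_assoc_pmf bind_return_pmf)
qed simp

lemma pmf_seq_pmf:
  "pmf (seq_pmf ps) xs = (if length xs = length ps then \<Prod>i<length ps. pmf (ps ! i) (xs ! i) else 0)"
proof (induction ps arbitrary: xs)
  case (Cons p ps)
  show ?case
  proof (cases xs)
    case Nil
    then show ?thesis
      by (metis length_seq_pmf list.distinct(1) length_0_conv pmf_eq_0_set_pmf)
  next
    case (Cons y ys)
    have "pmf (map_pmf ((#) x) (seq_pmf ps)) (y # ys) = indicator {y} x * pmf (seq_pmf ps) ys" for x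
    proof (cases "x = y")
      case True
      then show ?thesis
        using pmf_map_inj'[of "(#) y" "seq_pmf ps" ys] by (simp add: inj_def)
    next
      case False
      then show ?thesis
        by (auto simp: pmf_eq_0_set_pmf)
    qed
    then have "pmf (seq_pmf (p # ps)) xs = pmf p y * pmf (seq_pmf ps) ys"
      by (simp add: Cons pmf_bind measure_pmf_single)
    then show ?thesis
      by (simp add: Cons Cons.IH prod.lessThan_Suc_shift del: prod.lessThan_Suc)
  qed
qed simp

section \<open>Variance of an indicator, and expectations of bounded functions\<close>

definition bernoulli_var :: "'a pmf \<Rightarrow> 'a set \<Rightarrow> real" where
  "bernoulli_var p S = measure_pmf.prob p S * (1 - measure_pmf.prob p S)"

lemma bernoulli_var_nonneg: "0 \<le> bernoulli_var p S"
  by (simp add: bernoulli_var_def)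

lemma bernoulli_var_le_1: "bernoulli_var p S \<le> 1"
  unfolding bernoulli_var_def by (intro mult_le_one) auto

lemma bernoulli_var_le_Compl: "bernoulli_var p S \<le> measure_pmf.prob p (- S)"
  using measure_pmf.prob_compl[of S p]
  by (simp add: bernoulli_var_def Compl_eq_Diff_UNIV mult_left_le_one_le)

lemma bernoulli_var_Compl: "bernoulli_var p (- S) = bernoulli_var p S"
  using measure_pmf.prob_compl[of S p]
  by (simp add: bernoulli_var_def Compl_eq_Diff_UNIV mult.commute)

lemma bernoulli_var_empty [simp]: "bernoulli_var p {} = 0"
  by (simp add: bernoulli_var_def)

lemma integrable_pmf_bounded:
  fixes f :: "'a \<Rightarrow> real"
  assumes "\<And>x. 0 \<le> f x" "\<And>x. f x \<le> c"
  shows "integrable (measure_pmf p) f"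
  using assms by (intro measure_pmf.integrable_const_bound[where B = c]) auto

lemma ennreal_expectation:
  fixes f :: "'a \<Rightarrow> real"
  assumes "\<And>x. 0 \<le> f x" "\<And>x. f x \<le> c"
  shows "ennreal (measure_pmf.expectation p f) = (\<integral>\<^sup>+x. ennreal (f x) \<partial>measure_pmf p)"
  using assms by (intro nn_integral_eq_integral[symmetric] integrable_pmf_bounded) auto

lemma expectation_le:
  fixes f :: "'a \<Rightarrow> real"
  assumes "\<And>x. 0 \<le> f x" "\<And>x. f x \<le> c"
  shows "measure_pmf.expectation p f \<le> c"
  using integral_mono[of "measure_pmf p" f "\<lambda>_. c"] integrable_pmf_bounded[of f c p] assms
  by simp

lemma expectation_bind_pmf:
  fixes f :: "'a \<Rightarrow> real"
  assumes "\<And>x. 0 \<le> f x" "\<And>x. f x \<le> c"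
  shows "measure_pmf.expectation (bind_pmf p q) f
    = measure_pmf.expectation p (\<lambda>x. measure_pmf.expectation (q x) f)"
proof -
  have "ennreal (measure_pmf.expectation (bind_pmf p q) f)
      = (\<integral>\<^sup>+x. ennreal (measure_pmf.expectation (q x) f) \<partial>measure_pmf p)"
    by (simp add: ennreal_expectation[of f c, OF assms])
  also have "\<dots> = ennreal (measure_pmf.expectation p (\<lambda>x. measure_pmf.expectation (q x) f))"
    by (intro ennreal_expectation[symmetric, where c = c] expectation_le Bochner_Integration.integral_nonneg assms)
  finally show ?thesis
    by (simp add: assms(1))
qed

lemma prob_bind_pmf:
  "measure_pmf.prob (bind_pmf p q) S = measure_pmf.expectation p (\<lambda>x. measure_pmf.prob (q x) S)"
  using expectation_bind_pmf[of "indicator S :: _ \<Rightarrow> real" 1 p q] by simp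

text \<open>For the indicator \<open>h\<close> of \<open>S\<close> this says that the variances of
  its two conditional means \<open>g\<close> and \<open>r\<close> add up to at most the variance of
  \<open>h\<close>. It is the nonnegativity of the second moment of
  \<open>h - g - r + \<theta>\<close>, the interaction term of the Hoeffding decomposition.\<close>

lemma pair_second_moments:
  fixes p :: "'a pmf" and q :: "'b pmf"
  defines "g \<equiv> \<lambda>S x. measure_pmf.prob q {y. (x, y) \<in> S}"
    and "r \<equiv> \<lambda>S y. measure_pmf.prob p {x. (x, y) \<in> S}"
    and "\<theta> \<equiv> measure_pmf.prob (pair_pmf p q)"
  shows "measure_pmf.expectation p (\<lambda>x. (g S x)\<^sup>2) + measure_pmf.expectation q (\<lambda>y. (r S y)\<^sup>2)
    \<le> \<theta> S + (\<theta> S)\<^sup>2"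
proof -
  define D where "D = pair_pmf p q"
  define h :: "'a \<times> 'b \<Rightarrow> real" where "h = indicator S"
  let ?E = "measure_pmf.expectation D"
  let ?g = "\<lambda>z. g S (fst z)" and ?r = "\<lambda>z. r S (snd z)"
  have b: "0 \<le> g S x" "g S x \<le> 1" "0 \<le> r S y" "r S y \<le> 1" "0 \<le> h z" "h z \<le> 1" for x y z
    by (auto simp: g_def r_def h_def indicator_def)
  have D1: "?E f = measure_pmf.expectation p (\<lambda>x. measure_pmf.expectation q (\<lambda>y. f (x, y)))"
    if "\<And>z. 0 \<le> f z" "\<And>z. f z \<le> 1" for f :: "_ \<Rightarrow> real"
    unfolding D_def pair_pmf_def map_pmf_def[symmetric]
    by (subst expectation_bind_pmf[where c = 1]) (simp_all add: that)
  have D2: "?E f = measure_pmf.expectation q (\<lambda>y. measure_pmf.expectation p (\<lambda>x. f (x, y)))"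
    if "\<And>z. 0 \<le> f z" "\<And>z. f z \<le> 1" for f :: "_ \<Rightarrow> real"
  proof -
    have "D = bind_pmf q (\<lambda>y. map_pmf (\<lambda>x. (x, y)) p)"
      unfolding D_def pair_pmf_def map_pmf_def by (rule bind_commute_pmf)
    then show ?thesis
      by (simp add: expectation_bind_pmf[where c = 1] that)
  qed
  have hg: "measure_pmf.expectation q (\<lambda>y. h (x, y)) = g S x" for x
  proof -
    have "(\<lambda>y. h (x, y)) = indicator {y. (x, y) \<in> S}"
      by (auto simp: h_def indicator_def)
    then show ?thesis by (simp add: g_def)
  qed
  have hr: "measure_pmf.expectation p (\<lambda>x. h (x, y)) = r S y" for y
  proof -
    have "(\<lambda>x. h (x, y)) = indicator {x. (x, y) \<in> S}"
      by (auto simp: h_def indicator_def)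
    then show ?thesis by (simp add: r_def)
  qed
  have Eh: "?E h = \<theta> S"
    by (simp add: h_def \<theta>_def D_def)
  have Eg: "measure_pmf.expectation p (g S) = \<theta> S" and Er: "measure_pmf.expectation q (r S) = \<theta> S"
    using D1[of h] D2[of h] b Eh by (simp_all add: hg hr)
  have e: "?E (\<lambda>z. h z * ?g z) = measure_pmf.expectation p (\<lambda>x. (g S x)\<^sup>2)"
      "?E (\<lambda>z. h z * ?r z) = measure_pmf.expectation q (\<lambda>y. (r S y)\<^sup>2)"
      "?E (\<lambda>z. ?g z * ?r z) = (\<theta> S)\<^sup>2"
    by (subst D1 D2, simp_all add: b mult_le_one hg hr power2_eq_square Eg Er)+
  have e2: "?E (\<lambda>z. (?g z)\<^sup>2) = measure_pmf.expectation p (\<lambda>x. (g S x)\<^sup>2)"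
      "?E (\<lambda>z. (?r z)\<^sup>2) = measure_pmf.expectation q (\<lambda>y. (r S y)\<^sup>2)"
      "?E ?g = \<theta> S" "?E ?r = \<theta> S"
    by (subst D1 D2, simp_all add: b power_le_one Eg Er)+
  have [simp]: "integrable (measure_pmf D) h" "integrable (measure_pmf D) ?g" "integrable (measure_pmf D) ?r"
    "integrable (measure_pmf D) (\<lambda>z. (?g z)\<^sup>2)" "integrable (measure_pmf D) (\<lambda>z. (?r z)\<^sup>2)"
    "integrable (measure_pmf D) (\<lambda>z. h z * ?g z)" "integrable (measure_pmf D) (\<lambda>z. h z * ?r z)"
    "integrable (measure_pmf D) (\<lambda>z. ?g z * ?r z)"
    by (rule integrable_pmf_bounded[where c = 1]; simp add: b power_le_one mult_le_one)+
  have sq: "(h z - ?g z - ?r z + \<theta> S)\<^sup>2 = (1 + 2 * \<theta> S) * h z + (?g z)\<^sup>2 + (?r z)\<^sup>2 + (\<theta> S)\<^sup>2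
     - 2 * (h z * ?g z) - 2 * (h z * ?r z) + 2 * (?g z * ?r z) - 2 * \<theta> S * ?g z - 2 * \<theta> S * ?r z" for z
  proof -
    have "h z * h z = h z" by (simp add: h_def indicator_def)
    then show ?thesis by (simp add: power2_eq_square algebra_simps)
  qed
  have "0 \<le> ?E (\<lambda>z. (h z - ?g z - ?r z + \<theta> S)\<^sup>2)"
    by simp
  also have "\<dots> = (1 + 2 * \<theta> S) * \<theta> S + measure_pmf.expectation p (\<lambda>x. (g S x)\<^sup>2)
     + measure_pmf.expectation q (\<lambda>y. (r S y)\<^sup>2) + (\<theta> S)\<^sup>2
     - 2 * measure_pmf.expectation p (\<lambda>x. (g S x)\<^sup>2) - 2 * measure_pmf.expectation q (\<lambda>y. (r S y)\<^sup>2)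
     + 2 * (\<theta> S)\<^sup>2 - 2 * \<theta> S * \<theta> S - 2 * \<theta> S * \<theta> S"
    unfolding sq by (simp add: e e2 Eh)
  finally show ?thesis
    by (simp add: power2_eq_square algebra_simps)
qed

text \<open>The Efron--Stein inequality for an indicator.\<close>

lemma bernoulli_var_seq_pmf_le:
  "bernoulli_var (seq_pmf ps) S
    \<le> (\<Sum>i<length ps. measure_pmf.expectation (seq_pmf ps) (\<lambda>xs. bernoulli_var (ps ! i) {x. xs[i := x] \<in> S}))"
proof (induction ps arbitrary: S)
  case Nil
  then show ?case
    by (auto simp: bernoulli_var_def measure_return_pmf indicator_def)
next
  case (Cons p ps)
  let ?q = "seq_pmf ps"
  let ?S = "\<lambda>x. {xs. x # xs \<in> S}" and ?R = "\<lambda>xs. {x. x # xs \<in> S}"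
  define g where "g x = measure_pmf.prob ?q (?S x)" for x
  define r where "r xs = measure_pmf.prob p (?R xs)" for xs
  define \<theta> where "\<theta> = measure_pmf.prob (seq_pmf (p # ps)) S"
  have b: "0 \<le> g x" "g x \<le> 1" "0 \<le> r y" "r y \<le> 1" for x y
    by (auto simp: g_def r_def)
  have pair: "seq_pmf (p # ps) = map_pmf (\<lambda>(x, xs). x # xs) (pair_pmf p ?q)"
    by (simp add: pair_pmf_def map_pmf_def bind_assoc_pmf bind_return_pmf)
  have \<theta>: "\<theta> = measure_pmf.prob (pair_pmf p ?q) {(x, xs). x # xs \<in> S}"
    unfolding \<theta>_def pair by (simp add: vimage_def split_def)
  have split: "measure_pmf.expectation (seq_pmf (p # ps)) f
      = measure_pmf.expectation p (\<lambda>x. measure_pmf.expectation ?q (\<lambda>xs. f (x # xs)))"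
    if "\<And>z. 0 \<le> f z" "\<And>z. f z \<le> 1" for f :: "_ \<Rightarrow> real"
    by (simp add: expectation_bind_pmf[of f 1] that)
  have Eg: "measure_pmf.expectation p g = \<theta>"
    unfolding \<theta>_def g_def by (simp add: prob_bind_pmf vimage_def)
  have Er: "measure_pmf.expectation ?q r = \<theta>"
  proof -
    have "seq_pmf (p # ps) = bind_pmf ?q (\<lambda>xs. map_pmf (\<lambda>x. x # xs) p)"
      by (simp add: map_pmf_def) (rule bind_commute_pmf)
    then show ?thesis
      unfolding \<theta>_def r_def by (simp only: prob_bind_pmf) (simp add: vimage_def)
  qed
  have int: "integrable (measure_pmf p) g" "integrable (measure_pmf p) (\<lambda>x. (g x)\<^sup>2)"
    "integrable (measure_pmf ?q) r" "integrable (measure_pmf ?q) (\<lambda>x. (r x)\<^sup>2)"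
    by (rule integrable_pmf_bounded[where c = 1]; simp add: b power_le_one)+
  have "measure_pmf.expectation p (\<lambda>x. (g x)\<^sup>2) + measure_pmf.expectation ?q (\<lambda>y. (r y)\<^sup>2) \<le> \<theta> + \<theta>\<^sup>2"
    using pair_second_moments[of p ?q "{(x, xs). x # xs \<in> S}"] by (simp add: g_def r_def \<theta>)
  \<comment> \<open>As \<open>g\<close> and \<open>r\<close> both have mean \<open>\<theta>\<close>,
    subtracting the bound from \<open>2 * \<theta>\<close> yields: the variance is at most the mean
    variance in the head plus the mean variance in the tail. The induction hypothesis then applies
    to the tail for each fixed head.\<close>
  then have "bernoulli_var (seq_pmf (p # ps)) S
      \<le> measure_pmf.expectation ?q (\<lambda>xs. bernoulli_var p (?R xs))
        + measure_pmf.expectation p (\<lambda>x. bernoulli_var ?q (?S x))"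
    using int Eg Er
    by (simp add: bernoulli_var_def del: seq_pmf.simps flip: g_def r_def \<theta>_def) (simp add: algebra_simps power2_eq_square)
  also have "measure_pmf.expectation p (\<lambda>x. bernoulli_var ?q (?S x))
      \<le> measure_pmf.expectation p (\<lambda>x. \<Sum>i<length ps. measure_pmf.expectation ?q
          (\<lambda>xs. bernoulli_var (ps ! i) {y. x # xs[i := y] \<in> S}))"
  proof (intro integral_mono)
    show "integrable (measure_pmf p) (\<lambda>x. bernoulli_var ?q (?S x))"
      by (intro integrable_pmf_bounded[where c = 1] bernoulli_var_nonneg bernoulli_var_le_1)
    show "integrable (measure_pmf p) (\<lambda>x. \<Sum>i<length ps. measure_pmf.expectation ?q
          (\<lambda>xs. bernoulli_var (ps ! i) {y. x # xs[i := y] \<in> S}))"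
      by (intro Bochner_Integration.integrable_sum integrable_pmf_bounded[where c = 1]
          expectation_le Bochner_Integration.integral_nonneg bernoulli_var_nonneg bernoulli_var_le_1)
  next
    fix x
    show "bernoulli_var ?q (?S x) \<le> (\<Sum>i<length ps. measure_pmf.expectation ?q
          (\<lambda>xs. bernoulli_var (ps ! i) {y. x # xs[i := y] \<in> S}))"
      using Cons.IH[of "?S x"] by simp
  qed
  also have "\<dots> = (\<Sum>i<length ps. measure_pmf.expectation (seq_pmf (p # ps))
      (\<lambda>xs. bernoulli_var ((p # ps) ! Suc i) {x. xs[Suc i := x] \<in> S}))"
  proof (subst Bochner_Integration.integral_sum)
    show "integrable (measure_pmf p)
        (\<lambda>x. measure_pmf.expectation ?q (\<lambda>xs. bernoulli_var (ps ! i) {y. x # xs[i := y] \<in> S}))" for i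
      by (intro integrable_pmf_bounded[where c = 1] expectation_le
          Bochner_Integration.integral_nonneg bernoulli_var_nonneg bernoulli_var_le_1)
    show "(\<Sum>i<length ps. measure_pmf.expectation p
          (\<lambda>x. measure_pmf.expectation ?q (\<lambda>xs. bernoulli_var (ps ! i) {y. x # xs[i := y] \<in> S})))
        = (\<Sum>i<length ps. measure_pmf.expectation (seq_pmf (p # ps))
          (\<lambda>xs. bernoulli_var ((p # ps) ! Suc i) {x. xs[Suc i := x] \<in> S}))"
      by (intro sum.cong refl, subst split) (auto simp: bernoulli_var_nonneg bernoulli_var_le_1)
  qed
  also have "measure_pmf.expectation ?q (\<lambda>xs. bernoulli_var p (?R xs))
      = measure_pmf.expectation (seq_pmf (p # ps)) (\<lambda>xs. bernoulli_var ((p # ps) ! 0) {x. xs[0 := x] \<in> S})"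
    by (subst split) (auto simp: bernoulli_var_nonneg bernoulli_var_le_1)
  finally show ?case
    by (simp add: sum.lessThan_Suc_shift del: sum.lessThan_Suc seq_pmf.simps)
qed

section \<open>Variance of the root state\<close>

lemma nn_integral_pmf_swap:
  "(\<integral>\<^sup>+x. \<integral>\<^sup>+y. f x y \<partial>measure_pmf q \<partial>measure_pmf p)
    = (\<integral>\<^sup>+y. \<integral>\<^sup>+x. f x y \<partial>measure_pmf p \<partial>measure_pmf q)"
proof -
  have "(\<integral>\<^sup>+x. \<integral>\<^sup>+y. f x y \<partial>measure_pmf q \<partial>measure_pmf p) = (\<integral>\<^sup>+z. f (fst z) (snd z) \<partial>measure_pmf (pair_pmf p q))"
    by (simp add: nn_integral_pair_pmf')
  also have "\<dots> = (\<integral>\<^sup>+y. \<integral>\<^sup>+x. f x y \<partial>measure_pmf p \<partial>measure_pmf q)"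
    by (subst pair_commute_pmf) (simp add: nn_integral_pair_pmf' split_def)
  finally show ?thesis .
qed

section \<open>Truncated trees and the law of the root state given such a tree\<close>

primrec gw_trunc :: "nat pmf \<Rightarrow> nat \<Rightarrow> tree pmf" where
  "gw_trunc chi 0 = return_pmf (Node [])"
| "gw_trunc chi (Suc n) = bind_pmf chi (\<lambda>k. map_pmf Node (replicate_pmf k (gw_trunc chi n)))"

text \<open>The law \<open>q_n(t)\<close> of the overview.\<close>

primrec root_law :: "'s automaton \<Rightarrow> 's pmf \<Rightarrow> nat \<Rightarrow> tree \<Rightarrow> 's pmf" where
  "root_law A \<nu> 0 t = \<nu>"
| "root_law A \<nu> (Suc n) t =
     map_pmf (\<lambda>s. A (count_list s)) (seq_pmf (map (root_law A \<nu> n) (children t)))"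

text \<open>The target set that a parent with target set \<open>B\<close> hands to child
  \<open>i\<close>. It overwrites entry \<open>i\<close> and so depends on the siblings only; all
  independence arguments rest on this.\<close>

definition pull :: "'s automaton \<Rightarrow> 's set \<Rightarrow> 's list \<Rightarrow> nat \<Rightarrow> 's set" where
  "pull A B s i = {\<gamma>. A (count_list (s[i := \<gamma>])) \<in> B}"

lemma pull_update [simp]: "pull A B (s[i := x]) i = pull A B s i"
  by (simp add: pull_def)

lemma root_law_truncate: "root_law A \<nu> n (truncate_tree n t) = root_law A \<nu> n t"
  by (induction n arbitrary: t) (simp_all add: o_def)

locale fixed_point =
  fixes A :: "('s::finite) automaton" and chi :: "nat pmf" and \<nu> :: "'s pmf"
  assumes fixed_point: "distributional_map A chi \<nu> = \<nu>"
begin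

abbreviation "state s \<equiv> A (count_list s)"

lemma bind_state: "bind_pmf chi (\<lambda>k. map_pmf state (replicate_pmf k \<nu>)) = \<nu>"
  using fixed_point by (simp add: distributional_map_def)

text \<open>The fixed point equation iterated \<open>n\<close> times: averaged over the tree, the
  root state has law \<open>\<nu>\<close> again.\<close>

lemma bind_gw_root_law: "bind_pmf (gw_trunc chi n) (root_law A \<nu> n) = \<nu>"
proof (induction n)
  case (Suc n)
  have "bind_pmf (gw_trunc chi (Suc n)) (root_law A \<nu> (Suc n))
      = bind_pmf chi (\<lambda>k. map_pmf state (bind_pmf (replicate_pmf k (gw_trunc chi n))
          (\<lambda>ts. seq_pmf (map (root_law A \<nu> n) ts))))"
    by (simp add: bind_assoc_pmf bind_map_pmf map_bind_pmf)
  also have "\<dots> = \<nu>"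
    by (simp only: bind_replicate_pmf_seq Suc.IH bind_state)
  finally show ?case .
qed (simp add: bind_return_pmf)

text \<open>The expected conditional variance \<open>V_n(B)\<close> of the overview.\<close>

definition mean_var :: "nat \<Rightarrow> 's set \<Rightarrow> ennreal" where
  "mean_var n B = (\<integral>\<^sup>+t. ennreal (bernoulli_var (root_law A \<nu> n t) B) \<partial>gw_trunc chi n)"

text \<open>The mean number of children that are handed the set \<open>C\<close>; these are the
  coefficients of the recursion in \<open>mean_var_Suc\<close>.\<close>

definition pull_mean :: "'s set \<Rightarrow> 's set \<Rightarrow> ennreal" where
  "pull_mean B C = (\<integral>\<^sup>+k. (\<Sum>i<k. emeasure (replicate_pmf k \<nu>) {s. pull A B s i = C}) \<partial>chi)"

lemma mean_var_empty [simp]: "mean_var n {} = 0"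
  by (simp add: mean_var_def)

text \<open>Exchanges \<open>{a}\<close>, whose variance controls convergence, for
  \<open>- {a}\<close>, the target set of a root in state \<open>a\<close>.\<close>

lemma mean_var_Compl: "mean_var n (- B) = mean_var n B"
  by (simp add: mean_var_def bernoulli_var_Compl)

text \<open>The one-sided bound is chosen to match the weights: \<open>- B\<close> has as its mass
  the sum of \<open>pmf \<nu> a\<close> over \<open>a \<notin> B\<close>.\<close>

lemma mean_var_0: "mean_var 0 B \<le> emeasure \<nu> (- B)"
  using bernoulli_var_le_Compl[of \<nu> B]
  by (simp add: mean_var_def measure_pmf.emeasure_eq_measure)

text \<open>Decouples the subtree of child \<open>i\<close> from the states of its siblings. Only
  the state of child \<open>i\<close> depends on that subtree, and \<open>g\<close> ignores it;
  averaging over all subtrees then makes the states i.i.d. with law \<open>\<nu>\<close>.\<close>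

lemma nn_integral_resample:
  fixes g :: "tree \<Rightarrow> 's list \<Rightarrow> ennreal"
  assumes "i < k" and g: "\<And>t s x. g t (s[i := x]) = g t s"
  shows "(\<integral>\<^sup>+ts. \<integral>\<^sup>+s. g (ts ! i) s \<partial>seq_pmf (map (root_law A \<nu> n) ts) \<partial>replicate_pmf k (gw_trunc chi n))
    = (\<integral>\<^sup>+s. \<integral>\<^sup>+t. g t s \<partial>gw_trunc chi n \<partial>replicate_pmf k \<nu>)"
proof -
  let ?G = "gw_trunc chi n" and ?q = "root_law A \<nu> n"
  have "(\<integral>\<^sup>+ts. \<integral>\<^sup>+s. g (ts ! i) s \<partial>seq_pmf (map ?q ts) \<partial>replicate_pmf k ?G)
      = (\<integral>\<^sup>+ts. \<integral>\<^sup>+t. \<integral>\<^sup>+s. g (ts[i := t] ! i) s \<partial>seq_pmf (map ?q (ts[i := t])) \<partial>?G \<partial>replicate_pmf k ?G)"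
    by (subst replicate_pmf_resample[OF \<open>i < k\<close>]) simp
  also have "\<dots> = (\<integral>\<^sup>+ts. \<integral>\<^sup>+t. \<integral>\<^sup>+s. g t s \<partial>seq_pmf (map ?q ts) \<partial>?G \<partial>replicate_pmf k ?G)"
  proof (rule nn_integral_cong_AE, rule AE_pmfI)
    fix ts assume "ts \<in> set_pmf (replicate_pmf k ?G)"
    then have "i < length ts"
      using \<open>i < k\<close> by (simp add: length_replicate_pmf)
    then show "(\<integral>\<^sup>+t. \<integral>\<^sup>+s. g (ts[i := t] ! i) s \<partial>seq_pmf (map ?q (ts[i := t])) \<partial>?G)
        = (\<integral>\<^sup>+t. \<integral>\<^sup>+s. g t s \<partial>seq_pmf (map ?q ts) \<partial>?G)"
      by (simp add: map_update seq_pmf_update g measure_pmf.emeasure_space_1)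
  qed
  also have "\<dots> = (\<integral>\<^sup>+ts. \<integral>\<^sup>+s. \<integral>\<^sup>+t. g t s \<partial>?G \<partial>seq_pmf (map ?q ts) \<partial>replicate_pmf k ?G)"
    by (rule nn_integral_cong, rule nn_integral_pmf_swap)
  also have "\<dots> = (\<integral>\<^sup>+s. \<integral>\<^sup>+t. g t s \<partial>?G \<partial>bind_pmf (replicate_pmf k ?G) (\<lambda>ts. seq_pmf (map ?q ts)))"
    by simp
  also have "\<dots> = (\<integral>\<^sup>+s. \<integral>\<^sup>+t. g t s \<partial>?G \<partial>replicate_pmf k \<nu>)"
    by (simp only: bind_replicate_pmf_seq bind_gw_root_law)
  finally show ?thesis .
qed

text \<open>Efron--Stein is applied for fixed subtrees of the children, whose states are then
  independent. The term of child \<open>i\<close> involves its own subtree and, through the pulled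
  set, the states of its siblings; \<open>nn_integral_resample\<close> averages over the two
  independently, and splitting by the value \<open>C\<close> of the pulled set gives
  products.\<close>

lemma mean_var_Suc: "mean_var (Suc n) B \<le> (\<Sum>C\<in>UNIV. pull_mean B C * mean_var n C)"
proof -
  let ?G = "gw_trunc chi n" and ?q = "root_law A \<nu> n"
  have "mean_var (Suc n) B = (\<integral>\<^sup>+k. \<integral>\<^sup>+ts. ennreal (bernoulli_var (seq_pmf (map ?q ts)) (state -` B))
      \<partial>replicate_pmf k ?G \<partial>chi)"
    by (simp add: mean_var_def bernoulli_var_def)
  also have "\<dots> \<le> (\<integral>\<^sup>+k. \<integral>\<^sup>+ts. (\<Sum>i<k. \<integral>\<^sup>+s. ennreal (bernoulli_var (?q (ts ! i)) (pull A B s i))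
      \<partial>seq_pmf (map ?q ts)) \<partial>replicate_pmf k ?G \<partial>chi)"
  proof (rule nn_integral_mono, rule nn_integral_mono_AE, rule AE_pmfI)
    fix k ts assume "ts \<in> set_pmf (replicate_pmf k ?G)"
    then have len: "length ts = k"
      by (rule length_replicate_pmf)
    have "ennreal (bernoulli_var (seq_pmf (map ?q ts)) (state -` B))
        \<le> ennreal (\<Sum>i<k. measure_pmf.expectation (seq_pmf (map ?q ts))
            (\<lambda>s. bernoulli_var (map ?q ts ! i) {x. s[i := x] \<in> state -` B}))"
      using bernoulli_var_seq_pmf_le[of "map ?q ts" "state -` B"] by (simp add: ennreal_leI len)
    also have "\<dots> = (\<Sum>i<k. ennreal (measure_pmf.expectation (seq_pmf (map ?q ts))
            (\<lambda>s. bernoulli_var (map ?q ts ! i) {x. s[i := x] \<in> state -` B})))"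
      by (intro sum_ennreal[symmetric] Bochner_Integration.integral_nonneg bernoulli_var_nonneg)
    also have "\<dots> = (\<Sum>i<k. \<integral>\<^sup>+s. ennreal (bernoulli_var (?q (ts ! i)) (pull A B s i))
      \<partial>seq_pmf (map ?q ts))"
      by (intro sum.cong refl)
        (simp add: ennreal_expectation[where c = 1] bernoulli_var_nonneg bernoulli_var_le_1 pull_def len)
    finally show "ennreal (bernoulli_var (seq_pmf (map ?q ts)) (state -` B))
        \<le> (\<Sum>i<k. \<integral>\<^sup>+s. ennreal (bernoulli_var (?q (ts ! i)) (pull A B s i)) \<partial>seq_pmf (map ?q ts))" .
  qed
  also have "\<dots> = (\<integral>\<^sup>+k. (\<Sum>i<k. \<integral>\<^sup>+s. mean_var n (pull A B s i) \<partial>replicate_pmf k \<nu>) \<partial>chi)"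
    by (intro nn_integral_cong)
      (simp add: nn_integral_sum mean_var_def
        nn_integral_resample[of _ _ "\<lambda>t s. ennreal (bernoulli_var (?q t) (pull A B s _))"])
  also have "\<dots> = (\<integral>\<^sup>+k. (\<Sum>i<k. \<Sum>C\<in>UNIV. emeasure (replicate_pmf k \<nu>) {s. pull A B s i = C} * mean_var n C) \<partial>chi)"
  proof (intro nn_integral_cong sum.cong refl)
    fix k i
    have *: "mean_var n (pull A B s i) = (\<Sum>C\<in>UNIV. indicator {s. pull A B s i = C} s * mean_var n C)" for s
      by (simp add: indicator_def if_distrib[of "\<lambda>x. x * _"] cong: if_cong)
    show "(\<integral>\<^sup>+s. mean_var n (pull A B s i) \<partial>replicate_pmf k \<nu>)
        = (\<Sum>C\<in>UNIV. emeasure (replicate_pmf k \<nu>) {s. pull A B s i = C} * mean_var n C)"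
      by (simp only: *, subst nn_integral_sum) (simp_all add: nn_integral_multc)
  qed
  also have "\<dots> = (\<Sum>C\<in>UNIV. pull_mean B C * mean_var n C)"
    by (subst sum.swap) (simp add: nn_integral_sum pull_mean_def nn_integral_multc flip: sum_distrib_right)
  finally show ?thesis .
qed

end

section \<open>Coloured trees and the branching property\<close>

text \<open>Countability for countable colour types is the point: a law on these trees is fixed by
  the masses of single trees, and every set of them can count as measurable.\<close>

datatype 's ctree = CNode (root_col: 's) (subs: "'s ctree list")

instance ctree :: (countable) countable
  by countable_datatype

text \<open>Decomposes at the root, as branching arguments require, whereas
  \<open>random_state_tree\<close> describes whole generations. \<open>pmf_ctree_law\<close> and
  \<open>emeasure_coloured\<close> identify the two descriptions.\<close>

primrec ctree_law :: "'s automaton \<Rightarrow> nat pmf \<Rightarrow> 's pmf \<Rightarrow> nat \<Rightarrow> 's ctree pmf" where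
  "ctree_law A chi \<nu> 0 = map_pmf (\<lambda>a. CNode a []) \<nu>"
| "ctree_law A chi \<nu> (Suc n) = bind_pmf chi (\<lambda>k.
     map_pmf (\<lambda>cs. CNode (A (count_list (map root_col cs))) cs) (replicate_pmf k (ctree_law A chi \<nu> n)))"

text \<open>\<open>ptype A B c v\<close> is the pair of the colour of \<open>v\<close> and the set of those new colours of \<open>v\<close> that
  move the root colour into \<open>B\<close>; with \<open>B\<close> the complement of the root colour it is the type of \<open>v\<close> in
  the pivot tree.\<close>

fun ptype :: "'s automaton \<Rightarrow> 's set \<Rightarrow> 's ctree \<Rightarrow> nat list \<Rightarrow> ('s \<times> 's set) option" where
  "ptype A B c [] = Some (root_col c, B)"
| "ptype A B c (i # v) = (if i < length (subs c)
     then ptype A (pull A B (map root_col (subs c)) i) (subs c ! i) v else None)"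

context fixed_point
begin

lemma root_col_ctree_law: "map_pmf root_col (ctree_law A chi \<nu> n) = \<nu>"
proof (induction n)
  case (Suc n)
  have "map_pmf root_col (ctree_law A chi \<nu> (Suc n))
      = bind_pmf chi (\<lambda>k. map_pmf state (map_pmf (map root_col) (replicate_pmf k (ctree_law A chi \<nu> n))))"
    by (simp add: map_bind_pmf map_pmf_comp)
  then show ?case
    by (simp only: map_replicate_pmf Suc.IH bind_state)
qed (simp add: map_pmf_comp)

text \<open>Restricted to the parent state \<open>fst i\<close> but not conditioned on it, hence
  \<open>pmf \<nu> (fst i)\<close> times the matrix entry for occurring types
  (\<open>mean_children_eq\<close>). The target set \<open>snd i\<close> is a parameter handed down
  from above.\<close>

definition type_mean :: "'s pivot_type \<Rightarrow> 's pivot_type \<Rightarrow> ennreal" where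
  "type_mean i j = (\<integral>\<^sup>+k. \<integral>\<^sup>+s. of_nat (card {l. l < k \<and> s ! l = fst j \<and> pull A (snd i) s l = snd j})
     * indicator {s. state s = fst i} s \<partial>replicate_pmf k \<nu> \<partial>chi)"

text \<open>The target set may depend on the colour of the root. The pivot tree has
  \<open>f a = - {a}\<close>, but further down the set handed to a child depends on the child's
  colour through the state of its parent, so the induction needs general \<open>f\<close>. The
  product form allows for types of probability zero.\<close>

lemma type_mean_root:
  fixes f :: "'s \<Rightarrow> 's set"
  shows "ennreal (pmf \<nu> (fst i)) * (\<integral>\<^sup>+c. of_nat (card {l. ptype A (f (root_col c)) c [l] = Some j})
      * indicator {c. ptype A (f (root_col c)) c [] = Some i} c \<partial>ctree_law A chi \<nu> (Suc 0))
    = type_mean i j * emeasure (ctree_law A chi \<nu> (Suc 0)) {c. ptype A (f (root_col c)) c [] = Some i}"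
proof -
  let ?H = "ctree_law A chi \<nu> (Suc 0)"
  have E: "emeasure ?H {c. ptype A (f (root_col c)) c [] = Some i}
      = (if f (fst i) = snd i then ennreal (pmf \<nu> (fst i)) else 0)"
  proof -
    have "emeasure ?H {c. ptype A (f (root_col c)) c [] = Some i}
        = emeasure (map_pmf root_col ?H) {a. (a, f a) = i}"
      by (simp add: vimage_def)
    also have "{a. (a, f a) = i} = (if f (fst i) = snd i then {fst i} else {})"
      by (cases i) auto
    finally show ?thesis
      by (simp only: root_col_ctree_law) (simp add: emeasure_pmf_single)
  qed
  have "(\<integral>\<^sup>+c. of_nat (card {l. ptype A (f (root_col c)) c [l] = Some j})
      * indicator {c. ptype A (f (root_col c)) c [] = Some i} c \<partial>?H)
    = (if f (fst i) = snd i then type_mean i j else 0)"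
  proof -
    have H1: "?H = bind_pmf chi (\<lambda>k. map_pmf (\<lambda>s. CNode (state s) (map (\<lambda>a. CNode a []) s)) (replicate_pmf k \<nu>))"
      by (simp add: map_replicate_pmf[symmetric] map_pmf_comp o_def)
    define c1 where "c1 s = CNode (state s) (map (\<lambda>a. CNode a []) s)" for s
    have "of_nat (card {l. ptype A (f (root_col (c1 s))) (c1 s) [l] = Some j})
        * (indicator {c. ptype A (f (root_col c)) c [] = Some i} (c1 s) :: ennreal)
      = (if f (fst i) = snd i then of_nat (card {l. l < k \<and> s ! l = fst j \<and> pull A (snd i) s l = snd j})
         * indicator {s. state s = fst i} s else 0)" if "s \<in> set_pmf (replicate_pmf k \<nu>)" for k s
    proof (cases "(state s, f (state s)) = i")
      case True
      have "(ptype A (f (state s)) (c1 s) [l] = Some j)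
          = (l < k \<and> s ! l = fst j \<and> pull A (f (state s)) s l = snd j)" for l
        using length_replicate_pmf[OF that] by (cases j) (auto simp: c1_def o_def)
      with True show ?thesis
        by (auto simp: c1_def)
    next
      case False
      then show ?thesis
        by (cases i) (auto simp: c1_def)
    qed
    then have "(\<integral>\<^sup>+s. of_nat (card {l. ptype A (f (root_col (c1 s))) (c1 s) [l] = Some j})
        * (indicator {c. ptype A (f (root_col c)) c [] = Some i} (c1 s) :: ennreal) \<partial>replicate_pmf k \<nu>)
      = (\<integral>\<^sup>+s. (if f (fst i) = snd i then of_nat (card {l. l < k \<and> s ! l = fst j \<and> pull A (snd i) s l = snd j})
         * indicator {s. state s = fst i} s else 0) \<partial>replicate_pmf k \<nu>)" for k
      by (intro nn_integral_cong_AE AE_pmfI)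
    then show ?thesis
      unfolding H1 type_mean_def c1_def[symmetric] nn_integral_bind_pmf nn_integral_map_pmf
      by (simp only:) simp
  qed
  with E show ?thesis
    by (simp add: mult.commute del: ctree_law.simps)
qed

text \<open>The branching property. With the siblings of child \<open>m\<close> frozen, the set
  handed to that child is a function of its own colour alone, so the induction hypothesis applies to
  its subtree with this function in place of \<open>f\<close>; both sides are then averaged over the
  siblings.\<close>

lemma type_mean_vertex:
  fixes f :: "'s \<Rightarrow> 's set"
  shows "ennreal (pmf \<nu> (fst i)) * (\<integral>\<^sup>+c. of_nat (card {l. ptype A (f (root_col c)) c (v @ [l]) = Some j})
      * indicator {c. ptype A (f (root_col c)) c v = Some i} c \<partial>ctree_law A chi \<nu> (Suc (length v)))
    = type_mean i j * emeasure (ctree_law A chi \<nu> (Suc (length v))) {c. ptype A (f (root_col c)) c v = Some i}"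
proof (induction v arbitrary: f)
  case Nil
  then show ?case using type_mean_root[of i f j] by simp
next
  case (Cons m v)
  let ?H = "ctree_law A chi \<nu> (Suc (length v))"
  define X where "X F c = of_nat (card {l. ptype A F c (v @ [l]) = Some j})
     * (indicator {c. ptype A F c v = Some i} c :: ennreal)" for F c
  define Y where "Y F c = (indicator {c. ptype A F c v = Some i} c :: ennreal)" for F c
  have IH: "ennreal (pmf \<nu> (fst i)) * (\<integral>\<^sup>+c. X (f (root_col c)) c \<partial>?H)
      = type_mean i j * (\<integral>\<^sup>+c. Y (f (root_col c)) c \<partial>?H)" for f
    using Cons.IH[of f] by (simp add: X_def Y_def indicator_def del: ctree_law.simps flip: nn_integral_indicator)
  define c0 where "c0 cs = CNode (state (map root_col cs)) cs" for cs
  define F where "F cs = pull A (f (state (map root_col cs))) (map root_col cs) m" for cs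
  have step: "ennreal (pmf \<nu> (fst i)) * (\<integral>\<^sup>+cs. X (F cs) (cs ! m) \<partial>replicate_pmf k ?H)
      = type_mean i j * (\<integral>\<^sup>+cs. Y (F cs) (cs ! m) \<partial>replicate_pmf k ?H)" if "m < k" for k
  proof -
    \<comment> \<open>\<open>F\<close> depends on child \<open>m\<close> only through the colour of
      the parent, because \<open>pull\<close> overwrites entry \<open>m\<close>. Resampling child
      \<open>m\<close> makes this dependence explicit.\<close>
    have R: "(\<integral>\<^sup>+cs. Z (F cs) (cs ! m) \<partial>replicate_pmf k ?H)
        = (\<integral>\<^sup>+cs. \<integral>\<^sup>+c. Z (pull A (f (state ((map root_col cs)[m := root_col c]))) (map root_col cs) m) c
             \<partial>?H \<partial>replicate_pmf k ?H)" for Z :: "_ \<Rightarrow> _ \<Rightarrow> ennreal"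
    proof -
      have "(\<integral>\<^sup>+cs. Z (F cs) (cs ! m) \<partial>replicate_pmf k ?H)
          = (\<integral>\<^sup>+cs. \<integral>\<^sup>+c. Z (F (cs[m := c])) (cs[m := c] ! m) \<partial>?H \<partial>replicate_pmf k ?H)"
        by (subst replicate_pmf_resample[OF that]) (simp del: ctree_law.simps)
      also have "\<dots> = (\<integral>\<^sup>+cs. \<integral>\<^sup>+c. Z (pull A (f (state ((map root_col cs)[m := root_col c]))) (map root_col cs) m) c
             \<partial>?H \<partial>replicate_pmf k ?H)"
        by (rule nn_integral_cong_AE, rule AE_pmfI)
          (use that in \<open>simp add: F_def map_update length_replicate_pmf del: ctree_law.simps\<close>)
      finally show ?thesis .
    qed
    show ?thesis
      unfolding R
      by (simp add: IH[of "\<lambda>a. pull A (f (state ((map root_col _)[m := a]))) (map root_col _) m"]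
          del: ctree_law.simps flip: nn_integral_cmult)
  qed
  have L: "(\<integral>\<^sup>+c. of_nat (card {l. ptype A (f (root_col c)) c ((m # v) @ [l]) = Some j})
      * indicator {c. ptype A (f (root_col c)) c (m # v) = Some i} c \<partial>ctree_law A chi \<nu> (Suc (length (m # v))))
     = (\<integral>\<^sup>+k. (if m < k then \<integral>\<^sup>+cs. X (F cs) (cs ! m) \<partial>replicate_pmf k ?H else 0) \<partial>chi)" (is "?l = ?r")
  proof -
    have "?l = (\<integral>\<^sup>+k. \<integral>\<^sup>+cs. of_nat (card {l. ptype A (f (root_col (c0 cs))) (c0 cs) ((m # v) @ [l]) = Some j})
      * indicator {c. ptype A (f (root_col c)) c (m # v) = Some i} (c0 cs) \<partial>replicate_pmf k ?H \<partial>chi)"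
      unfolding c0_def by (simp only: ctree_law.simps(2)[of _ _ _ "Suc (length v)"] list.size add_0_right add_Suc_right
        nn_integral_bind_pmf nn_integral_map_pmf)
    also have "\<dots> = ?r"
    proof (rule nn_integral_cong)
      fix k
      have "of_nat (card {l. ptype A (f (root_col (c0 cs))) (c0 cs) ((m # v) @ [l]) = Some j})
          * indicator {c. ptype A (f (root_col c)) c (m # v) = Some i} (c0 cs)
        = (if m < k then X (F cs) (cs ! m) else 0)" if "cs \<in> set_pmf (replicate_pmf k ?H)" for cs
        using length_replicate_pmf[OF that] by (simp add: c0_def X_def F_def indicator_def)
      then have "(\<integral>\<^sup>+cs. of_nat (card {l. ptype A (f (root_col (c0 cs))) (c0 cs) ((m # v) @ [l]) = Some j})
          * indicator {c. ptype A (f (root_col c)) c (m # v) = Some i} (c0 cs) \<partial>replicate_pmf k ?H)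
        = (\<integral>\<^sup>+cs. (if m < k then X (F cs) (cs ! m) else 0) \<partial>replicate_pmf k ?H)"
        by (intro nn_integral_cong_AE AE_pmfI)
      then show "(\<integral>\<^sup>+cs. of_nat (card {l. ptype A (f (root_col (c0 cs))) (c0 cs) ((m # v) @ [l]) = Some j})
          * indicator {c. ptype A (f (root_col c)) c (m # v) = Some i} (c0 cs) \<partial>replicate_pmf k ?H)
        = (if m < k then \<integral>\<^sup>+cs. X (F cs) (cs ! m) \<partial>replicate_pmf k ?H else 0)"
        by (simp del: ctree_law.simps)
    qed
    finally show ?thesis .
  qed
  have R: "emeasure (ctree_law A chi \<nu> (Suc (length (m # v)))) {c. ptype A (f (root_col c)) c (m # v) = Some i}
     = (\<integral>\<^sup>+k. (if m < k then \<integral>\<^sup>+cs. Y (F cs) (cs ! m) \<partial>replicate_pmf k ?H else 0) \<partial>chi)" (is "?l = ?r")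
  proof -
    have "?l = (\<integral>\<^sup>+c. indicator {c. ptype A (f (root_col c)) c (m # v) = Some i} c \<partial>ctree_law A chi \<nu> (Suc (length (m # v))))"
      by (rule nn_integral_indicator[symmetric]) simp
    also have "\<dots> = (\<integral>\<^sup>+k. \<integral>\<^sup>+cs. indicator {c. ptype A (f (root_col c)) c (m # v) = Some i} (c0 cs) \<partial>replicate_pmf k ?H \<partial>chi)"
      unfolding c0_def by (simp only: ctree_law.simps(2)[of _ _ _ "Suc (length v)"] list.size add_0_right add_Suc_right
        nn_integral_bind_pmf nn_integral_map_pmf)
    also have "\<dots> = ?r"
    proof (rule nn_integral_cong)
      fix k
      have "indicator {c. ptype A (f (root_col c)) c (m # v) = Some i} (c0 cs)
        = (if m < k then Y (F cs) (cs ! m) else 0)" if "cs \<in> set_pmf (replicate_pmf k ?H)" for cs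
        using length_replicate_pmf[OF that] by (simp add: c0_def Y_def F_def indicator_def)
      then have "(\<integral>\<^sup>+cs. indicator {c. ptype A (f (root_col c)) c (m # v) = Some i} (c0 cs) \<partial>replicate_pmf k ?H)
        = (\<integral>\<^sup>+cs. (if m < k then Y (F cs) (cs ! m) else 0) \<partial>replicate_pmf k ?H)"
        by (intro nn_integral_cong_AE AE_pmfI)
      then show "(\<integral>\<^sup>+cs. indicator {c. ptype A (f (root_col c)) c (m # v) = Some i} (c0 cs) \<partial>replicate_pmf k ?H)
        = (if m < k then \<integral>\<^sup>+cs. Y (F cs) (cs ! m) \<partial>replicate_pmf k ?H else 0)"
        by (simp del: ctree_law.simps)
    qed
    finally show ?thesis .
  qed
  have cmult: "a * (\<integral>\<^sup>+k. h k \<partial>measure_pmf chi) = (\<integral>\<^sup>+k. a * h k \<partial>measure_pmf chi)" for a h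
    by (simp add: nn_integral_cmult)
  show ?case
    unfolding L R cmult by (rule nn_integral_cong) (use step in \<open>simp del: ctree_law.simps\<close>)
qed

text \<open>Setting entry \<open>l\<close> to its own value changes nothing, so an entry
  \<open>c\<close> outside its pulled set \<open>C\<close> forces the state out of \<open>B\<close>:
  the sum over \<open>a \<notin> B\<close> misses no child. The factor \<open>pmf \<nu> c\<close>
  splits off because the pulled set ignores entry \<open>l\<close>.\<close>

lemma sum_type_mean:
  assumes "c \<notin> C"
  shows "(\<Sum>a\<in>- B. type_mean (a, B) (c, C)) = pull_mean B C * ennreal (pmf \<nu> c)"
proof -
  have "(\<Sum>a\<in>- B. of_nat (card {l. l < k \<and> s ! l = c \<and> pull A B s l = C}) * indicator {s. state s = a} s)
      = (\<Sum>l<k. indicator {s. s ! l = c \<and> pull A B s l = C} s :: ennreal)"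
    if "s \<in> set_pmf (replicate_pmf k \<nu>)" for k s
  proof -
    note len = length_replicate_pmf[OF that]
    have "state s \<notin> B" if "l < k" "s ! l = c" "pull A B s l = C" for l
    proof -
      have "s ! l \<notin> pull A B s l"
        using that assms by simp
      then show ?thesis
        by (simp add: pull_def)
    qed
    then have "(of_nat (card {l. l < k \<and> s ! l = c \<and> pull A B s l = C}) :: ennreal) * indicator (- B) (state s)
        = of_nat (card {l. l < k \<and> s ! l = c \<and> pull A B s l = C})"
      by (cases "state s \<in> B") auto
    moreover have "(\<Sum>a\<in>- B. indicator {s. state s = a} s) = (indicator (- B) (state s) :: ennreal)"
      by (simp add: indicator_def)
    moreover have "(\<Sum>l<k. indicator {s. s ! l = c \<and> pull A B s l = C} s :: ennreal)
        = of_nat (card {l. l < k \<and> s ! l = c \<and> pull A B s l = C})"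
      by (simp add: indicator_def sum.If_cases Int_def flip: of_nat_sum)
    ultimately show ?thesis
      by (simp flip: sum_distrib_left)
  qed
  note pointwise = this
  have "(\<Sum>a\<in>- B. type_mean (a, B) (c, C))
      = (\<integral>\<^sup>+k. (\<Sum>a\<in>- B. \<integral>\<^sup>+s. of_nat (card {l. l < k \<and> s ! l = c \<and> pull A B s l = C})
          * indicator {s. state s = a} s \<partial>replicate_pmf k \<nu>) \<partial>chi)"
    unfolding type_mean_def fst_conv snd_conv by (rule nn_integral_sum[symmetric]) simp
  also have "\<dots> = (\<integral>\<^sup>+k. \<integral>\<^sup>+s. (\<Sum>a\<in>- B. of_nat (card {l. l < k \<and> s ! l = c \<and> pull A B s l = C})
          * indicator {s. state s = a} s) \<partial>replicate_pmf k \<nu> \<partial>chi)"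
    by (rule nn_integral_cong, rule nn_integral_sum[symmetric]) simp
  also have "\<dots> = (\<integral>\<^sup>+k. \<integral>\<^sup>+s. (\<Sum>l<k. indicator {s. s ! l = c \<and> pull A B s l = C} s) \<partial>replicate_pmf k \<nu> \<partial>chi)"
    by (rule nn_integral_cong, rule nn_integral_cong_AE, rule AE_pmfI, rule pointwise)
  also have "\<dots> = (\<integral>\<^sup>+k. (\<Sum>l<k. emeasure (replicate_pmf k \<nu>) {s. pull A B s l = C} * ennreal (pmf \<nu> c)) \<partial>chi)"
  proof (rule nn_integral_cong)
    fix k
    have "(\<integral>\<^sup>+s. indicator {s. s ! l = c \<and> pull A B s l = C} s \<partial>replicate_pmf k \<nu>)
        = emeasure (replicate_pmf k \<nu>) {s. pull A B s l = C} * ennreal (pmf \<nu> c)" if "l < k" for l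
    proof -
      have "(\<integral>\<^sup>+s. indicator {s. s ! l = c \<and> pull A B s l = C} s \<partial>replicate_pmf k \<nu>)
          = (\<integral>\<^sup>+s. \<integral>\<^sup>+x. indicator {s. s ! l = c \<and> pull A B s l = C} (s[l := x]) \<partial>\<nu> \<partial>replicate_pmf k \<nu>)"
        by (subst replicate_pmf_resample[OF that]) simp
      also have "\<dots> = (\<integral>\<^sup>+s. \<integral>\<^sup>+x. indicator {s. pull A B s l = C} s * indicator {c} x \<partial>\<nu> \<partial>replicate_pmf k \<nu>)"
        by (rule nn_integral_cong_AE, rule AE_pmfI)
          (use that in \<open>auto intro!: nn_integral_cong simp: length_replicate_pmf indicator_def\<close>)
      also have "\<dots> = emeasure (replicate_pmf k \<nu>) {s. pull A B s l = C} * ennreal (pmf \<nu> c)"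
        by (simp add: nn_integral_cmult nn_integral_multc emeasure_pmf_single)
      finally show ?thesis .
    qed
    then show "(\<integral>\<^sup>+s. (\<Sum>l<k. indicator {s. s ! l = c \<and> pull A B s l = C} s) \<partial>replicate_pmf k \<nu>)
        = (\<Sum>l<k. emeasure (replicate_pmf k \<nu>) {s. pull A B s l = C} * ennreal (pmf \<nu> c))"
      by (subst nn_integral_sum) (auto intro!: sum.cong)
  qed
  also have "\<dots> = pull_mean B C * ennreal (pmf \<nu> c)"
    by (simp add: pull_mean_def nn_integral_multc flip: sum_distrib_right)
  finally show ?thesis .
qed

end

section \<open>Galton--Watson trees\<close>

lemma vertices_Nil [simp]: "[] \<in> vertices t"
  and vertices_Cons [simp]: "i # v \<in> vertices t \<longleftrightarrow> i < length (children t) \<and> v \<in> vertices (children t ! i)"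
  by (simp_all add: vertices_def)

lemma num_children_Nil [simp]: "num_children t [] = length (children t)"
  and num_children_Cons [simp]: "num_children t (i # v) = num_children (children t ! i) v"
  by (simp_all add: num_children_def)

lemma vertices_snoc [simp]: "v @ [i] \<in> vertices t \<longleftrightarrow> v \<in> vertices t \<and> i < num_children t v"
  by (induction v arbitrary: t) auto

lemma vertices_truncate: "v \<in> vertices (truncate_tree n t) \<longleftrightarrow> v \<in> vertices t \<and> length v \<le> n"
proof (induction n arbitrary: t v)
  case 0
  then show ?case by (cases v) auto
next
  case (Suc n)
  then show ?case by (cases v) auto
qed

lemma truncate_truncate: "truncate_tree n (truncate_tree n t) = truncate_tree n t"
  by (induction n arbitrary: t) auto

lemma generation_0 [simp]: "generation 0 t = {[]}"
  by (auto simp: generation_def)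

lemma generation_Suc:
  "generation (Suc n) t = (\<Union>i<length (children t). (#) i ` generation n (children t ! i))"
proof (rule Set.set_eqI)
  fix v
  show "v \<in> generation (Suc n) t \<longleftrightarrow> v \<in> (\<Union>i<length (children t). (#) i ` generation n (children t ! i))"
    by (cases v) (auto simp: generation_def)
qed

lemma finite_generation: "finite (generation n t)"
  by (induction n arbitrary: t) (auto simp: generation_Suc)

text \<open>The bound is strict because a truncation at \<open>n\<close> shows the vertices of
  generation \<open>n\<close> but not their numbers of children.\<close>

definition inner_vertices :: "nat \<Rightarrow> tree \<Rightarrow> nat list set" where
  "inner_vertices n t = {v \<in> vertices t. length v < n}"

lemma inner_vertices_0 [simp]: "inner_vertices 0 t = {}"
  by (simp add: inner_vertices_def)

lemma inner_vertices_Suc: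
  "inner_vertices (Suc n) t = insert [] (\<Union>i<length (children t). (#) i ` inner_vertices n (children t ! i))"
proof (rule Set.set_eqI)
  fix v
  show "v \<in> inner_vertices (Suc n) t \<longleftrightarrow>
      v \<in> insert [] (\<Union>i<length (children t). (#) i ` inner_vertices n (children t ! i))"
    by (cases v) (auto simp: inner_vertices_def)
qed

lemma finite_inner_vertices: "finite (inner_vertices n t)"
  by (induction n arbitrary: t) (auto simp: inner_vertices_Suc)

lemma prod_Cons_UN:
  fixes g :: "nat list \<Rightarrow> 'a::comm_monoid_mult"
  assumes "\<And>i. i < k \<Longrightarrow> finite (S i)"
  shows "(\<Prod>v\<in>(\<Union>i<k. (#) i ` S i). g v) = (\<Prod>i<k. \<Prod>v\<in>S i. g (i # v))"
proof -
  have "(\<Prod>v\<in>(\<Union>i<k. (#) i ` S i). g v) = (\<Prod>i<k. \<Prod>v\<in>(#) i ` S i. g v)"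
    using assms by (intro prod.UNION_disjoint) auto
  then show ?thesis
    by (simp add: prod.reindex)
qed

section \<open>Measurability and cylinder probabilities on the tree space\<close>

lemma space_tree_space [simp]: "space tree_space = UNIV"
  by (simp add: tree_space_def space_measure_of_conv)

lemma countable_range_truncate: "countable (range (truncate_tree n))"
proof (induction n)
  case (Suc n)
  have "range (truncate_tree (Suc n)) \<subseteq> Node ` lists (range (truncate_tree n))"
    by (auto intro!: imageI)
  with Suc show ?case
    by (meson countable_image countable_lists countable_subset)
qed simp

lemma truncate_eq_sets: "{t. truncate_tree n t = s} \<in> sets tree_space"
proof (cases "s \<in> range (truncate_tree n)")
  case True
  then obtain t where "s = truncate_tree n t" by auto
  then have "{t. truncate_tree n t = s} \<in> {{t'. truncate_tree n t' = truncate_tree n t} | n t. True}"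
    by (intro CollectI exI[of _ n] exI[of _ t]) simp
  then show ?thesis
    unfolding tree_space_def by (rule in_measure_of[rotated]) simp
next
  case False
  then have "{t. truncate_tree n t = s} = {}" by auto
  then show ?thesis by simp
qed

text \<open>Preimages are unions of sets \<open>{t. truncate_tree n t = s}\<close>, and only
  countably many \<open>s\<close> arise, whatever the sigma-algebra of \<open>N\<close> is.\<close>

lemma measurable_truncate_determined:
  assumes "\<And>t t'. truncate_tree n t = truncate_tree n t' \<Longrightarrow> f t = f t'" and "range f \<subseteq> space N"
  shows "f \<in> tree_space \<rightarrow>\<^sub>M N"
proof (rule measurableI)
  fix Y assume "Y \<in> sets N"
  have "t \<in> f -` Y" if "truncate_tree n t = truncate_tree n t'" "t' \<in> f -` Y" for t t'
    using assms(1)[OF that(1)] that(2) by simp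
  then have "f -` Y \<inter> space tree_space = (\<Union>s\<in>truncate_tree n ` (f -` Y). {t. truncate_tree n t = s})"
    by auto
  also have "\<dots> \<in> sets tree_space"
    by (intro sets.countable_UN' truncate_eq_sets countable_subset[OF _ countable_range_truncate[of n]])
      (auto simp: truncate_eq_sets)
  finally show "f -` Y \<inter> space tree_space \<in> sets tree_space" .
qed (use assms(2) in auto)

text \<open>Turns the generators of \<open>tree_space\<close> into finite-dimensional cylinders of
  the i.i.d. field of child counts. Both the measurability of \<open>tree_of_counts\<close> and the
  cylinder probabilities of \<open>GW\<close> follow from it.\<close>

lemma truncate_tree_of_counts_iff:
  assumes "truncate_tree n s = s"
  shows "truncate_tree n (tree_of_counts k) = s \<longleftrightarrow> (\<forall>v\<in>inner_vertices n s. k v = num_children s v)"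
  using assms
proof (induction n arbitrary: s k)
  case (Suc n)
  obtain ss where s: "s = Node ss" by (cases s)
  with Suc.prems have map_ss: "map (truncate_tree n) ss = ss"
    by simp
  have ss: "truncate_tree n (ss ! i) = ss ! i" if "i < length ss" for i
    using arg_cong[OF map_ss, of "\<lambda>xs. xs ! i"] that by simp
  have "truncate_tree (Suc n) (tree_of_counts k) = s \<longleftrightarrow>
      k [] = length ss \<and> (\<forall>i<length ss. truncate_tree n (tree_of_counts (\<lambda>v. k (i # v))) = ss ! i)"
    by (auto simp add: s list_eq_iff_nth_eq simp del: truncate_tree.simps(1))
  also have "\<dots> \<longleftrightarrow> k [] = length ss \<and>
      (\<forall>i<length ss. \<forall>v\<in>inner_vertices n (ss ! i). k (i # v) = num_children (ss ! i) v)"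
    by (intro conj_cong refl all_cong Suc.IH ss)
  also have "\<dots> \<longleftrightarrow> (\<forall>v\<in>inner_vertices (Suc n) s. k v = num_children s v)"
    by (simp add: inner_vertices_Suc s) blast
  finally show ?case .
qed simp

abbreviation counts :: "nat pmf \<Rightarrow> (nat list \<Rightarrow> nat) measure" where
  "counts chi \<equiv> PiM UNIV (\<lambda>_. measure_pmf chi)"

lemma emeasure_counts_cylinder:
  assumes "finite J"
  shows "{k. \<forall>v\<in>J. k v = m v} \<in> sets (counts chi)"
    and "emeasure (counts chi) {k. \<forall>v\<in>J. k v = m v} = (\<Prod>v\<in>J. ennreal (pmf chi (m v)))"
proof -
  have eq: "{k. \<forall>v\<in>J. k v = m v} = prod_emb UNIV (\<lambda>_. measure_pmf chi) J (\<Pi>\<^sub>E v\<in>J. {m v})"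
    by (auto simp: prod_emb_def PiE_def Pi_def)
  show "{k. \<forall>v\<in>J. k v = m v} \<in> sets (counts chi)"
    unfolding eq using assms by (intro sets_PiM_I) auto
  show "emeasure (counts chi) {k. \<forall>v\<in>J. k v = m v} = (\<Prod>v\<in>J. ennreal (pmf chi (m v)))"
    unfolding eq using assms
    by (subst emeasure_PiM_emb) (auto simp: emeasure_pmf_single measure_pmf.prob_space_axioms)
qed

lemma measurable_tree_of_counts [measurable]: "tree_of_counts \<in> counts chi \<rightarrow>\<^sub>M tree_space"
  unfolding tree_space_def
proof (rule measurable_measure_of)
  fix y assume "y \<in> {{t'. truncate_tree n t' = truncate_tree n t} | n t. True}"
  then obtain n t where y: "y = {t'. truncate_tree n t' = truncate_tree n t}" by auto
  show "tree_of_counts -` y \<inter> space (counts chi) \<in> sets (counts chi)"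
    using emeasure_counts_cylinder(1)[OF finite_inner_vertices[of n "truncate_tree n t"]]
    by (simp add: y vimage_def truncate_tree_of_counts_iff truncate_truncate space_PiM)
qed auto

lemma emeasure_GW_truncate:
  assumes "truncate_tree n s = s"
  shows "emeasure (GW chi) {t. truncate_tree n t = s}
    = (\<Prod>v\<in>inner_vertices n s. ennreal (pmf chi (num_children s v)))"
proof -
  have "emeasure (GW chi) {t. truncate_tree n t = s}
      = emeasure (counts chi) {k. truncate_tree n (tree_of_counts k) = s}"
    unfolding GW_def by (subst emeasure_distr) (auto simp: truncate_eq_sets vimage_def space_PiM)
  then show ?thesis
    using emeasure_counts_cylinder(2)[OF finite_inner_vertices[of n s]]
    by (simp add: truncate_tree_of_counts_iff assms)
qed

section \<open>Coloured truncations\<close>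

primrec shape :: "'s ctree \<Rightarrow> tree" where
  "shape (CNode a cs) = Node (map shape cs)"

fun col :: "'s ctree \<Rightarrow> nat list \<Rightarrow> 's" where
  "col c [] = root_col c"
| "col c (i # v) = col (subs c ! i) v"

primrec admissible :: "'s automaton \<Rightarrow> nat \<Rightarrow> 's ctree \<Rightarrow> bool" where
  "admissible A 0 c \<longleftrightarrow> subs c = []"
| "admissible A (Suc n) c \<longleftrightarrow> root_col c = A (count_list (map root_col (subs c))) \<and>
     (\<forall>i<length (subs c). admissible A n (subs c ! i))"

text \<open>Reads \<open>\<tau>\<close> only at vertices of \<open>t\<close>, the only addresses at
  which \<open>random_state_tree\<close> makes the colours measurable.\<close>

primrec ctrunc :: "nat \<Rightarrow> tree \<Rightarrow> (nat list \<Rightarrow> 's) \<Rightarrow> 's ctree" where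
  "ctrunc 0 t \<tau> = CNode (\<tau> []) []"
| "ctrunc (Suc n) t \<tau> = CNode (\<tau> [])
     (map (\<lambda>i. ctrunc n (children t ! i) (\<lambda>v. \<tau> (i # v))) [0..<length (children t)])"

lemma children_shape [simp]: "children (shape c) = map shape (subs c)"
  by (cases c) simp

lemma root_col_ctrunc [simp]: "root_col (ctrunc n t \<tau>) = \<tau> []"
  by (cases n) simp_all

lemma shape_ctrunc [simp]: "shape (ctrunc n t \<tau>) = truncate_tree n t"
proof (induction n arbitrary: t \<tau>)
  case (Suc n)
  have "map (\<lambda>i. truncate_tree n (children t ! i)) [0..<length (children t)] = map (truncate_tree n) (children t)"
    by (rule nth_equalityI) auto
  then show ?case
    by (simp add: Suc.IH o_def)
qed simp

lemma truncate_shape: "admissible A n c \<Longrightarrow> truncate_tree n (shape c) = shape c"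
proof (induction n arbitrary: c)
  case 0
  then show ?case by (cases c) simp
next
  case (Suc n)
  have "truncate_tree n (shape c') = shape c'" if "c' \<in> set (subs c)" for c'
    using Suc.prems that by (intro Suc.IH) (auto simp only: admissible.simps in_set_conv_nth)
  then show ?case by (cases c) simp
qed

lemma map_upt_eq_iff: "map f [0..<k] = xs \<longleftrightarrow> length xs = k \<and> (\<forall>i<k. f i = xs ! i)"
  by (auto simp: list_eq_iff_nth_eq)

lemma map_eq_map_iff:
  "map f xs = map g ys \<longleftrightarrow> length ys = length xs \<and> (\<forall>i<length xs. f (xs ! i) = g (ys ! i))"
  by (auto simp: list_eq_iff_nth_eq)

lemma ctrunc_Suc_eq_iff:
  "ctrunc (Suc n) t \<tau> = c \<longleftrightarrow> root_col c = \<tau> [] \<and> length (subs c) = length (children t) \<and>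
     (\<forall>i<length (children t). ctrunc n (children t ! i) (\<lambda>v. \<tau> (i # v)) = subs c ! i)"
  by (cases c) (simp add: map_upt_eq_iff eq_commute[of "\<tau> []"])

lemma truncate_Suc_eq_iff:
  "truncate_tree (Suc n) t = shape c \<longleftrightarrow> length (subs c) = length (children t) \<and>
     (\<forall>i<length (children t). truncate_tree n (children t ! i) = shape (subs c ! i))"
  by (cases c) (simp add: map_eq_map_iff)

text \<open>Holds without compatibility, hence at every point of \<open>M\<close> and not just
  almost surely; it serves measurability. Its counterpart for probabilities is
  \<open>ctrunc_eq_iff\<close>.\<close>

lemma ctrunc_eq_iff_vertices:
  "ctrunc n t \<tau> = c \<longleftrightarrow> truncate_tree n t = shape c \<and> (\<forall>v\<in>vertices (shape c). \<tau> v = col c v)"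
proof (induction n arbitrary: t \<tau> c)
  case 0
  have V: "vertices (Node []) = {[]}"
  proof (rule Set.set_eqI)
    fix v show "v \<in> vertices (Node []) \<longleftrightarrow> v \<in> {[]}"
      by (cases v) simp_all
  qed
  obtain a cs where c: "c = CNode a cs" by (cases c)
  show ?case
    unfolding c by (cases cs) (simp_all add: V)
next
  case (Suc n)
  have V: "(\<forall>v\<in>vertices (shape c). P v) \<longleftrightarrow>
      P [] \<and> (\<forall>i<length (subs c). \<forall>v\<in>vertices (shape (subs c ! i)). P (i # v))" (is "?l \<longleftrightarrow> ?r")
    for P :: "nat list \<Rightarrow> bool"
  proof
    assume ?r
    then have "P v" if "v \<in> vertices (shape c)" for v
      using that by (cases v) auto
    then show ?l by blast
  next
    assume l: ?l
    then have "P (i # v)" if "i < length (subs c)" "v \<in> vertices (shape (subs c ! i))" for i v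
      using that by (intro bspec[OF l]) simp
    with l show ?r by auto
  qed
  show ?case
    unfolding ctrunc_Suc_eq_iff truncate_Suc_eq_iff Suc.IH V by auto
qed

lemma finite_vertices_truncate: "finite (vertices (truncate_tree n t))"
proof -
  have "vertices (truncate_tree n t) \<subseteq> inner_vertices (Suc n) (truncate_tree n t)"
    by (auto simp: inner_vertices_def vertices_truncate)
  then show ?thesis
    using finite_inner_vertices finite_subset by blast
qed

section \<open>Recomputed colours and pivot types read off a coloured truncation\<close>

lemma card_eq_count_list: "card {i. i < k \<and> f i = \<sigma>} = count_list (map f [0..<k]) \<sigma>"
proof -
  have "{i. i < k \<and> f i = \<sigma>} = {i \<in> {..<k}. f i = \<sigma>}" by auto
  then show ?thesis
    by (simp add: count_list_eq_length_filter filter_map o_def eq_commute[of \<sigma>] distinct_length_filter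
      Int_def flip: lessThan_atLeast0) (metis (no_types, lifting) lessThan_iff)
qed

lemma parent_state_Nil:
  "parent_state A t \<tau> [] = A (count_list (map (\<lambda>i. \<tau> [i]) [0..<length (children t)]))"
  by (simp add: parent_state_def card_eq_count_list[abs_def])

lemma parent_state_Cons:
  "parent_state A t \<tau> (i # v) = parent_state A (children t ! i) (\<lambda>u. \<tau> (i # u)) v"
  by (simp add: parent_state_def)

lemma recompute_Cons:
  "recompute A t \<tau> d (i # v) = recompute A (children t ! i) (\<lambda>u. \<tau> (i # u)) d v"
  by (induction d arbitrary: v) (simp_all add: parent_state_Cons[abs_def] parent_state_def)

lemma compatible_child:
  "compatible A t \<tau> \<Longrightarrow> i < length (children t) \<Longrightarrow> compatible A (children t ! i) (\<lambda>v. \<tau> (i # v))"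
  unfolding compatible_def by (auto simp: parent_state_Cons dest!: bspec[where x = "i # _"])

lemma compatible_root:
  "compatible A t \<tau> \<Longrightarrow> \<tau> [] = A (count_list (map (\<lambda>i. \<tau> [i]) [0..<length (children t)]))"
  unfolding compatible_def by (metis vertices_Nil parent_state_Nil)

lemma recompute_compatible:
  assumes "compatible A t \<tau>" "v \<in> vertices t"
  shows "recompute A t \<tau> d v = \<tau> v"
  using assms(2)
proof (induction d arbitrary: v)
  case (Suc d)
  have "{i. i < num_children t v \<and> recompute A t \<tau> d (v @ [i]) = \<sigma>}
      = {i. i < num_children t v \<and> \<tau> (v @ [i]) = \<sigma>}" for \<sigma>
    using Suc by auto
  then have "recompute A t \<tau> (Suc d) v = parent_state A t \<tau> v"
    by (simp add: parent_state_def)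
  then show ?case
    using assms(1) Suc.prems by (simp add: compatible_def)
qed simp

text \<open>Compatibility forces all colours before generation \<open>n\<close>, so the last
  generation decides, and its conditional law is known.\<close>

lemma ctrunc_eq_iff:
  assumes "compatible A t \<tau>"
  shows "ctrunc n t \<tau> = c \<longleftrightarrow>
    admissible A n c \<and> truncate_tree n t = shape c \<and> (\<forall>v\<in>generation n (shape c). \<tau> v = col c v)"
  using assms
proof (induction n arbitrary: t \<tau> c)
  case 0
  then show ?case by (cases c) auto
next
  case (Suc n)
  have G: "(\<forall>v\<in>generation (Suc n) (shape c). P v) \<longleftrightarrow>
      (\<forall>i<length (subs c). \<forall>v\<in>generation n (shape (subs c ! i)). P (i # v))" for P
    by (auto simp: generation_Suc)
  have IH: "ctrunc n (children t ! i) (\<lambda>v. \<tau> (i # v)) = subs c ! i \<longleftrightarrow>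
      admissible A n (subs c ! i) \<and> truncate_tree n (children t ! i) = shape (subs c ! i) \<and>
      (\<forall>v\<in>generation n (shape (subs c ! i)). \<tau> (i # v) = col (subs c ! i) v)"
    if "i < length (children t)" for i
    using Suc.IH[OF compatible_child[OF Suc.prems that]] .
  have root: "root_col c = \<tau> [] \<longleftrightarrow> root_col c = A (count_list (map root_col (subs c)))"
    if "length (subs c) = length (children t)"
      "\<forall>i<length (children t). ctrunc n (children t ! i) (\<lambda>v. \<tau> (i # v)) = subs c ! i"
  proof -
    have "root_col (subs c ! i) = \<tau> [i]" if "i < length (children t)" for i
      using \<open>\<forall>i<length (children t). _ i\<close> that root_col_ctrunc by metis
    then have "map root_col (subs c) = map (\<lambda>i. \<tau> [i]) [0..<length (children t)]"
      by (intro nth_equalityI) (simp_all add: that)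
    then show ?thesis
      using compatible_root[OF Suc.prems] by simp
  qed
  have "ctrunc (Suc n) t \<tau> = c \<longleftrightarrow> root_col c = A (count_list (map root_col (subs c))) \<and>
      length (subs c) = length (children t) \<and>
      (\<forall>i<length (children t). ctrunc n (children t ! i) (\<lambda>v. \<tau> (i # v)) = subs c ! i)"
    unfolding ctrunc_Suc_eq_iff using root by blast
  also have "\<dots> \<longleftrightarrow> admissible A (Suc n) c \<and> truncate_tree (Suc n) t = shape c \<and>
      (\<forall>v\<in>generation (Suc n) (shape c). \<tau> v = col c v)"
    unfolding truncate_Suc_eq_iff G using IH by auto
  finally show ?case .
qed

text \<open>Recolouring \<open>v\<close> disturbs only the path from \<open>v\<close> to the root,
  since compatibility returns the old colours at all other children. So each step up changes a
  single entry in a list of child colours, and \<open>pull\<close> takes the preimage under this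
  change.\<close>

lemma ptype_ctrunc:
  assumes "compatible A t \<tau>" "length v \<le> n"
  shows "ptype A B (ctrunc n t \<tau>) v = (if v \<in> vertices t
    then Some (\<tau> v, {\<gamma>. recompute A t (\<tau>(v := \<gamma>)) (length v) [] \<in> B}) else None)"
  using assms
proof (induction v arbitrary: n t \<tau> B)
  case Nil
  then show ?case by simp
next
  case (Cons i v)
  then obtain n' where n: "n = Suc n'" "length v \<le> n'"
    by (cases n) auto
  show ?case
  proof (cases "i < length (children t)")
    case True
    let ?\<tau> = "\<lambda>u. \<tau> (i # u)" and ?s = "map (\<lambda>j. \<tau> [j]) [0..<length (children t)]"
    have r: "recompute A t (\<tau>(i # v := \<gamma>)) (length (i # v)) []
        = A (count_list (?s[i := recompute A (children t ! i) (?\<tau>(v := \<gamma>)) (length v) []]))" for \<gamma>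
    proof -
      have upd: "(\<lambda>u. (\<tau>(i # v := \<gamma>)) (i # u)) = ?\<tau>(v := \<gamma>)"
        "j \<noteq> i \<Longrightarrow> (\<lambda>u. (\<tau>(i # v := \<gamma>)) (j # u)) = (\<lambda>u. \<tau> (j # u))" for j
        by auto
      have "map (\<lambda>j. recompute A t (\<tau>(i # v := \<gamma>)) (length v) [j]) [0..<length (children t)]
          = ?s[i := recompute A (children t ! i) (?\<tau>(v := \<gamma>)) (length v) []]"
      proof (rule nth_equalityI)
        fix j assume "j < length (map (\<lambda>j. recompute A t (\<tau>(i # v := \<gamma>)) (length v) [j]) [0..<length (children t)])"
        then have j: "j < length (children t)" by simp
        show "map (\<lambda>j. recompute A t (\<tau>(i # v := \<gamma>)) (length v) [j]) [0..<length (children t)] ! j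
            = ?s[i := recompute A (children t ! i) (?\<tau>(v := \<gamma>)) (length v) []] ! j"
          using j recompute_compatible[OF compatible_child[OF Cons.prems(1) j], of "[]"]
          by (cases "j = i") (simp_all add: recompute_Cons upd del: fun_upd_apply)
      qed simp
      then show ?thesis
        by (simp add: parent_state_Nil del: fun_upd_apply)
    qed
    have "ptype A B (ctrunc n t \<tau>) (i # v) = ptype A (pull A B ?s i) (ctrunc n' (children t ! i) ?\<tau>) v"
      using True by (simp add: n o_def)
    also have "\<dots> = (if v \<in> vertices (children t ! i) then Some (?\<tau> v,
        {\<gamma>. recompute A (children t ! i) (?\<tau>(v := \<gamma>)) (length v) [] \<in> pull A B ?s i}) else None)"
      by (rule Cons.IH[OF compatible_child[OF Cons.prems(1) True] n(2)])
    also have "\<dots> = (if i # v \<in> vertices t then Some (\<tau> (i # v),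
        {\<gamma>. recompute A t (\<tau>(i # v := \<gamma>)) (length (i # v)) [] \<in> B}) else None)"
      unfolding r using True by (simp add: pull_def)
    finally show ?thesis .
  next
    case False
    then show ?thesis by (simp add: n)
  qed
qed

lemma pivot_of_type_iff:
  assumes "compatible A t \<tau>" "length v \<le> n"
  shows "pivot_of_type A t \<tau> v i \<longleftrightarrow> snd i \<noteq> {} \<and> ptype A (- {\<tau> []}) (ctrunc n t \<tau>) v = Some i"
  unfolding ptype_ctrunc[OF assms] pivot_of_type_def pivot_tree_def target_set_def recolour_def
  by (cases i) auto

section \<open>The law of the coloured truncations\<close>

lemma num_children_eqI:
  assumes "\<And>i. v @ [i] \<in> vertices t \<longleftrightarrow> v @ [i] \<in> vertices t'" "v \<in> vertices t" "v \<in> vertices t'"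
  shows "num_children t v = num_children t' v"
  using assms(1)[of "num_children t v"] assms(1)[of "num_children t' v"] assms(2,3)
  by (metis less_irrefl_nat linorder_neqE_nat vertices_snoc)

lemma vertices_cong:
  assumes "truncate_tree n t = truncate_tree n t'" "length v \<le> n"
  shows "v \<in> vertices t \<longleftrightarrow> v \<in> vertices t'"
  using assms vertices_truncate by metis

lemma recompute_cong:
  assumes tr: "truncate_tree n t = truncate_tree n t'"
    and eq: "\<And>v. v \<in> vertices t \<Longrightarrow> length v \<le> n \<Longrightarrow> \<tau> v = \<tau>' v"
    and "u \<in> vertices t" "length u + d \<le> n"
  shows "recompute A t \<tau> d u = recompute A t' \<tau>' d u"
  using assms(3,4)
proof (induction d arbitrary: u)
  case 0
  then show ?case by (simp add: eq)
next
  case (Suc d)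
  have "num_children t u = num_children t' u"
  proof (rule num_children_eqI)
    show "u @ [i] \<in> vertices t \<longleftrightarrow> u @ [i] \<in> vertices t'" for i
      using Suc.prems by (intro vertices_cong[OF tr]) simp
  qed (use Suc.prems vertices_cong[OF tr, of u] in auto)
  moreover have "recompute A t \<tau> d (u @ [i]) = recompute A t' \<tau>' d (u @ [i])" if "i < num_children t u" for i
    using that Suc.prems by (intro Suc.IH) auto
  ultimately have "{i. i < num_children t u \<and> recompute A t \<tau> d (u @ [i]) = \<sigma>}
      = {i. i < num_children t' u \<and> recompute A t' \<tau>' d (u @ [i]) = \<sigma>}" for \<sigma>
    by auto
  then show ?case
    by (simp add: parent_state_def)
qed

lemma col_ctrunc: "v \<in> vertices (truncate_tree n t) \<Longrightarrow> col (ctrunc n t \<tau>) v = \<tau> v"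
  using ctrunc_eq_iff_vertices[of n t \<tau> "ctrunc n t \<tau>"] by simp

text \<open>Stated without compatibility, so that \<open>sets_pivot\<close> gets exact measurability
  and not merely equality up to a null set.\<close>

lemma pivot_of_type_cong:
  assumes "ctrunc n t \<tau> = ctrunc n t' \<tau>'" "length v \<le> n"
  shows "pivot_of_type A t \<tau> v i \<longleftrightarrow> pivot_of_type A t' \<tau>' v i"
proof -
  have tr: "truncate_tree n t = truncate_tree n t'"
    using arg_cong[OF assms(1), of shape] by simp
  have eq: "\<tau> u = \<tau>' u" if "u \<in> vertices t" "length u \<le> n" for u
    using that assms(1) col_ctrunc vertices_truncate tr by metis
  have "target_set A t \<tau> v = target_set A t' \<tau>' v"
  proof -
    have "recompute A t (\<tau>(v := \<gamma>)) (length v) [] = recompute A t' (\<tau>'(v := \<gamma>)) (length v) []" for \<gamma>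
      using assms(2) eq by (intro recompute_cong[OF tr]) auto
    moreover have "\<tau> [] = \<tau>' []"
      by (rule eq) simp_all
    ultimately show ?thesis
      by (simp add: target_set_def recolour_def)
  qed
  then show ?thesis
    using eq vertices_cong[OF tr assms(2)] assms(2)
    by (auto simp: pivot_of_type_def pivot_tree_def)
qed

context fixed_point
begin

text \<open>The factors match the random state tree: the first product is the \<open>GW\<close> mass
  of the truncated tree, the second the conditional probability of the colours in generation
  \<open>n\<close>.\<close>

lemma pmf_ctree_law:
  "pmf (ctree_law A chi \<nu> n) c = (if admissible A n c
    then (\<Prod>v\<in>inner_vertices n (shape c). pmf chi (num_children (shape c) v)) *
         (\<Prod>v\<in>generation n (shape c). pmf \<nu> (col c v))
    else 0)"
proof (induction n arbitrary: c)
  case 0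
  obtain a cs where c: "c = CNode a cs" by (cases c)
  show ?case
  proof (cases "cs = []")
    case True
    have "pmf (map_pmf (\<lambda>a. CNode a []) \<nu>) (CNode a []) = pmf \<nu> a"
      by (rule pmf_map_inj') (auto simp: inj_def)
    then show ?thesis by (simp add: c True)
  next
    case False
    then have "c \<notin> set_pmf (map_pmf (\<lambda>a. CNode a []) \<nu>)"
      by (auto simp: c)
    then show ?thesis
      using False by (simp add: c pmf_eq_0_set_pmf)
  qed
next
  case (Suc n)
  let ?H = "ctree_law A chi \<nu> n"
  let ?F = "\<lambda>cs. CNode (state (map root_col cs)) cs"
  obtain a cs where c: "c = CNode a cs" by (cases c)
  show ?case
  proof (cases "a = state (map root_col cs)")
    case True
    have "pmf (map_pmf ?F (replicate_pmf k ?H)) c = indicator {length cs} k * (\<Prod>i<length cs. pmf ?H (cs ! i))" for k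
    proof -
      have "pmf (map_pmf ?F (replicate_pmf k ?H)) (?F cs) = pmf (replicate_pmf k ?H) cs"
        by (rule pmf_map_inj') (auto simp: inj_def)
      also have "\<dots> = indicator {length cs} k * (\<Prod>i<length cs. pmf ?H (cs ! i))"
        using pmf_seq_pmf[of "replicate k ?H" cs] by (auto simp: seq_pmf_replicate indicator_def)
      finally show ?thesis by (simp add: c True)
    qed
    then have "pmf (ctree_law A chi \<nu> (Suc n)) c = pmf chi (length cs) * (\<Prod>i<length cs. pmf ?H (cs ! i))"
      by (simp add: pmf_bind measure_pmf_single)
    also have "\<dots> = (if admissible A (Suc n) c
        then (\<Prod>v\<in>inner_vertices (Suc n) (shape c). pmf chi (num_children (shape c) v)) *
             (\<Prod>v\<in>generation (Suc n) (shape c). pmf \<nu> (col c v))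
        else 0)"
    proof (cases "\<forall>i<length cs. admissible A n (cs ! i)")
      case adm: True
      have "(\<Prod>v\<in>inner_vertices (Suc n) (shape c). pmf chi (num_children (shape c) v))
          = pmf chi (length cs) * (\<Prod>i<length cs. \<Prod>v\<in>inner_vertices n (shape (cs ! i)).
              pmf chi (num_children (shape (cs ! i)) v))"
      proof -
        have "(\<Prod>v\<in>inner_vertices (Suc n) (shape c). pmf chi (num_children (shape c) v))
            = pmf chi (length cs) * (\<Prod>v\<in>(\<Union>i<length cs. (#) i ` inner_vertices n (shape (cs ! i))).
              pmf chi (num_children (shape c) v))"
          unfolding inner_vertices_Suc
          by (subst prod.insert) (auto simp: c finite_inner_vertices intro!: prod.cong)
        then show ?thesis
          by (simp add: prod_Cons_UN finite_inner_vertices c)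
      qed
      moreover have "(\<Prod>v\<in>generation (Suc n) (shape c). pmf \<nu> (col c v))
          = (\<Prod>i<length cs. \<Prod>v\<in>generation n (shape (cs ! i)). pmf \<nu> (col (cs ! i) v))"
        by (simp add: generation_Suc c prod_Cons_UN finite_generation)
      ultimately show ?thesis
        using adm by (simp add: Suc.IH c True prod.distrib)
    next
      case False
      then have "\<exists>i\<in>{..<length cs}. pmf ?H (cs ! i) = 0"
        by (auto simp: Suc.IH)
      then have "(\<Prod>i<length cs. pmf ?H (cs ! i)) = 0"
        by (intro prod_zero) auto
      moreover have "\<not> admissible A (Suc n) c"
        using False by (simp add: c)
      ultimately show ?thesis
        by (simp only: if_False mult_zero_right)
    qed
    finally show ?thesis .
  next
    case False
    then have "c \<notin> set_pmf (ctree_law A chi \<nu> (Suc n))"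
      by (auto simp: c)
    then show ?thesis
      using False by (simp add: c pmf_eq_0_set_pmf del: ctree_law.simps)
  qed
qed

end

section \<open>Coloured truncations of the random state tree\<close>

locale state_tree = fixed_point A chi \<nu> for A :: "('s::finite) automaton" and chi \<nu> +
  fixes M :: "'b measure" and T :: "'b \<Rightarrow> tree" and \<omega> :: "'b \<Rightarrow> nat list \<Rightarrow> 's"
  assumes random_state_tree: "random_state_tree A chi \<nu> M T \<omega>"
begin

lemma prob_space_M: "prob_space M"
  and measurable_T [measurable]: "T \<in> M \<rightarrow>\<^sub>M tree_space"
  and sets_colour: "{x \<in> space M. v \<in> vertices (T x) \<and> \<omega> x v = \<sigma>} \<in> sets M"
  and distr_T: "distr M tree_space T = GW chi"
  and prob_generation: "\<P>(x in M. truncate_tree n (T x) = s \<and> (\<forall>v\<in>generation n s. \<omega> x v = c v)) =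
        \<P>(x in M. truncate_tree n (T x) = s) * (\<Prod>v\<in>generation n s. pmf \<nu> (c v))"
  and AE_compatible: "AE x in M. compatible A (T x) (\<omega> x)"
  using random_state_tree by (simp_all add: random_state_tree_def)

sublocale prob_space M by (rule prob_space_M)

abbreviation coloured :: "nat \<Rightarrow> 'b \<Rightarrow> 's ctree" where
  "coloured n x \<equiv> ctrunc n (T x) (\<omega> x)"

lemma sets_truncate_T: "{x \<in> space M. truncate_tree n (T x) = s} \<in> sets M"
  using measurable_sets[OF measurable_T truncate_eq_sets[of n s]]
  by (simp add: vimage_def Int_def conj_commute)

lemma sets_colours_on:
  assumes "V \<subseteq> vertices s" and s: "truncate_tree n s = s"
  shows "{x \<in> space M. truncate_tree n (T x) = s \<and> (\<forall>v\<in>V. \<omega> x v = c v)} \<in> sets M"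
proof -
  have "finite V"
    using finite_vertices_truncate[of n s] assms finite_subset by auto
  \<comment> \<open>On this event \<open>v \<in> vertices (T x)\<close> is automatic; it is inserted
    because \<open>sets_colour\<close> covers only colours at actual vertices.\<close>
  have "{x \<in> space M. truncate_tree n (T x) = s \<and> (\<forall>v\<in>V. \<omega> x v = c v)}
      = {x \<in> space M. truncate_tree n (T x) = s \<and> (\<forall>v\<in>V. v \<in> vertices (T x) \<and> \<omega> x v = c v)}"
    using assms(1) vertices_truncate by blast
  also have "\<dots> = {x \<in> space M. truncate_tree n (T x) = s} \<inter>
      {x \<in> space M. \<forall>v\<in>V. v \<in> vertices (T x) \<and> \<omega> x v = c v}"
    by auto
  also have "\<dots> \<in> sets M"
    using \<open>finite V\<close> by (intro sets.Int sets_truncate_T sets.sets_Collect_finite_All sets_colour)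
  finally show ?thesis .
qed

lemma emeasure_truncate_T:
  assumes "truncate_tree n s = s"
  shows "emeasure M {x \<in> space M. truncate_tree n (T x) = s}
    = (\<Prod>v\<in>inner_vertices n s. ennreal (pmf chi (num_children s v)))"
proof -
  have "emeasure M {x \<in> space M. truncate_tree n (T x) = s}
      = emeasure (distr M tree_space T) {t. truncate_tree n t = s}"
    by (subst emeasure_distr) (auto simp: truncate_eq_sets intro!: arg_cong[where f = "emeasure M"])
  then show ?thesis
    by (simp add: distr_T emeasure_GW_truncate[OF assms])
qed

lemma sets_coloured_eq: "{x \<in> space M. coloured n x = c} \<in> sets M"
proof (cases "truncate_tree n (shape c) = shape c")
  case True
  then show ?thesis
    unfolding ctrunc_eq_iff_vertices by (intro sets_colours_on) auto
next
  case False
  then have "truncate_tree n t \<noteq> shape c" for t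
    using truncate_truncate by metis
  then show ?thesis
    by (simp add: ctrunc_eq_iff_vertices)
qed

lemma measurable_coloured [measurable]: "coloured n \<in> M \<rightarrow>\<^sub>M count_space UNIV"
  using sets_coloured_eq[of n]
  by (simp add: measurable_count_space_eq_countable vimage_def Int_def conj_commute)

text \<open>For admissible \<open>c\<close> the event almost surely concerns only the truncated tree
  and generation \<open>n\<close>, where \<open>prob_generation\<close> gives its mass. For any
  other \<open>c\<close>, compatibility makes it a null event.\<close>

lemma emeasure_coloured: "emeasure M {x \<in> space M. coloured n x = c} = ennreal (pmf (ctree_law A chi \<nu> n) c)"
proof (cases "admissible A n c")
  case True
  note s = truncate_shape[OF True]
  have "emeasure M {x \<in> space M. coloured n x = c}
      = emeasure M {x \<in> space M. truncate_tree n (T x) = shape c \<and> (\<forall>v\<in>generation n (shape c). \<omega> x v = col c v)}"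
    using AE_compatible s
    by (intro emeasure_eq_AE sets_coloured_eq sets_colours_on)
      (auto simp: ctrunc_eq_iff True generation_def col_ctrunc elim!: eventually_mono)
  also have "\<dots> = ennreal (\<P>(x in M. truncate_tree n (T x) = shape c) * (\<Prod>v\<in>generation n (shape c). pmf \<nu> (col c v)))"
    by (simp add: emeasure_eq_measure prob_generation)
  also have "\<dots> = emeasure M {x \<in> space M. truncate_tree n (T x) = shape c} *
      ennreal (\<Prod>v\<in>generation n (shape c). pmf \<nu> (col c v))"
    by (simp add: emeasure_eq_measure ennreal_mult prod_nonneg)
  also have "\<dots> = ennreal (pmf (ctree_law A chi \<nu> n) c)"
    by (simp add: emeasure_truncate_T[OF s] pmf_ctree_law True ennreal_mult prod_nonneg prod_ennreal)
  finally show ?thesis .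
next
  case False
  have "coloured n x \<noteq> c" if "compatible A (T x) (\<omega> x)" for x
    using ctrunc_eq_iff[OF that, of n c] False by simp
  then have "emeasure M {x \<in> space M. coloured n x = c} = emeasure M {}"
    using AE_compatible
    by (intro emeasure_eq_AE sets_coloured_eq) (auto elim!: eventually_mono)
  then show ?thesis
    by (simp add: pmf_ctree_law False)
qed

lemma distr_coloured: "distr M (count_space UNIV) (coloured n) = measure_pmf (ctree_law A chi \<nu> n)"
proof (rule measure_eqI_countable[where A = UNIV])
  fix c
  show "emeasure (distr M (count_space UNIV) (coloured n)) {c} = emeasure (ctree_law A chi \<nu> n) {c}"
    using emeasure_coloured[of n c]
    by (subst emeasure_distr) (auto simp: emeasure_pmf_single vimage_def Int_def conj_commute)
qed auto

lemma nn_integral_coloured: "(\<integral>\<^sup>+x. f (coloured n x) \<partial>M) = (\<integral>\<^sup>+c. f c \<partial>ctree_law A chi \<nu> n)"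
  by (subst distr_coloured[symmetric], subst nn_integral_distr) auto

lemma sets_pivot: "{x \<in> space M. pivot_of_type A (T x) (\<omega> x) v i} \<in> sets M"
proof -
  \<comment> \<open>\<open>Q\<close> is the image of the event under truncation. Its preimage is no
    larger than the event, by \<open>pivot_of_type_cong\<close>.\<close>
  define Q where "Q = {coloured (length v) x | x. pivot_of_type A (T x) (\<omega> x) v i}"
  have "{x \<in> space M. pivot_of_type A (T x) (\<omega> x) v i} = coloured (length v) -` Q \<inter> space M"
    by (auto simp: Q_def dest: pivot_of_type_cong[where v = v and A = A and i = i])
  also have "\<dots> \<in> sets M"
    by (rule measurable_sets[OF measurable_coloured]) simp
  finally show ?thesis .
qed

lemma emeasure_pivot:
  assumes "snd i \<noteq> {}" "length v \<le> n"
  shows "emeasure M {x \<in> space M. pivot_of_type A (T x) (\<omega> x) v i}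
    = emeasure (ctree_law A chi \<nu> n) {c. ptype A (- {root_col c}) c v = Some i}"
proof -
  have "emeasure M {x \<in> space M. pivot_of_type A (T x) (\<omega> x) v i}
      = (\<integral>\<^sup>+x. indicator {c. ptype A (- {root_col c}) c v = Some i} (coloured n x) \<partial>M)"
    unfolding nn_integral_indicator[OF sets_pivot, symmetric]
    using AE_compatible assms
    by (intro nn_integral_cong_AE) (auto simp: pivot_of_type_iff indicator_def elim!: eventually_mono)
  then show ?thesis
    by (simp add: nn_integral_coloured)
qed

abbreviation "types \<equiv> occurring_types A M T \<omega>"
abbreviation "means \<equiv> mean_children A M T \<omega>"

lemma occurring_types_iff:
  "i \<in> types \<longleftrightarrow> (\<exists>v. emeasure M {x \<in> space M. pivot_of_type A (T x) (\<omega> x) v i} > 0)"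
proof -
  have "{x \<in> space M. \<exists>v. pivot_of_type A (T x) (\<omega> x) v i}
      = (\<Union>v. {x \<in> space M. pivot_of_type A (T x) (\<omega> x) v i})"
    by auto
  moreover have "emeasure M (\<Union>v. {x \<in> space M. pivot_of_type A (T x) (\<omega> x) v i}) = 0 \<longleftrightarrow>
      (\<forall>v. emeasure M {x \<in> space M. pivot_of_type A (T x) (\<omega> x) v i} = 0)"
  proof
    assume "emeasure M (\<Union>v. {x \<in> space M. pivot_of_type A (T x) (\<omega> x) v i}) = 0"
    then show "\<forall>v. emeasure M {x \<in> space M. pivot_of_type A (T x) (\<omega> x) v i} = 0"
      by (metis (no_types, lifting) UNIV_I UN_upper emeasure_mono sets.countable_UN' countableI_type
          image_subset_iff sets_pivot le_zero_eq)
  next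
    assume "\<forall>v. emeasure M {x \<in> space M. pivot_of_type A (T x) (\<omega> x) v i} = 0"
    then have "(\<Union>v. {x \<in> space M. pivot_of_type A (T x) (\<omega> x) v i}) \<in> null_sets M"
      using sets_pivot by (intro null_sets_UN null_setsI) auto
    then show "emeasure M (\<Union>v. {x \<in> space M. pivot_of_type A (T x) (\<omega> x) v i}) = 0"
      by auto
  qed
  ultimately show ?thesis
    unfolding occurring_types_def
    by (simp add: emeasure_eq_measure zero_less_measure_iff)
qed

end

section \<open>Mean offspring numbers\<close>

text \<open>Entry \<open>i\<close> of the \<open>n\<close>-th matrix power applied to the all-ones
  vector; for the matrix of means, the expected size of generation \<open>n\<close> of a multitype
  tree whose root has type \<open>i\<close>.\<close>

primrec total_mean :: "'i set \<Rightarrow> ('i \<Rightarrow> 'i \<Rightarrow> ennreal) \<Rightarrow> nat \<Rightarrow> 'i \<Rightarrow> ennreal" where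
  "total_mean I m 0 i = 1"
| "total_mean I m (Suc n) i = (\<Sum>j\<in>I. m i j * total_mean I m n j)"

context state_tree
begin

lemma occurring_types_nonempty: "i \<in> types \<Longrightarrow> snd i \<noteq> {}"
proof
  assume "i \<in> types" "snd i = {}"
  then have "{x \<in> space M. pivot_of_type A (T x) (\<omega> x) v i} = {}" for v
    by (auto simp: pivot_of_type_def pivot_tree_def)
  with \<open>i \<in> types\<close> show False
    by (simp add: occurring_types_iff)
qed

text \<open>By \<open>type_mean_vertex\<close> the probability of type \<open>i\<close> at
  \<open>v\<close> cancels in the quotient. What remains does not mention \<open>v\<close>, so the
  choice of vertex in \<open>mean_children\<close> is immaterial. For the second claim, a type that
  never occurs has almost surely no representative among the children of \<open>v\<close>.\<close>

lemma type_mean_eq_mean_children_at: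
  assumes "pmf \<nu> (fst i) \<noteq> 0" "snd j \<noteq> {}"
    and pos: "emeasure M {x \<in> space M. pivot_of_type A (T x) (\<omega> x) v i} > 0"
  shows "ennreal (pmf \<nu> (fst i)) * mean_children_at A M T \<omega> v i j = type_mean i j"
    and "type_mean i j > 0 \<Longrightarrow> j \<in> types"
proof -
  let ?H = "ctree_law A chi \<nu> (Suc (length v))"
  let ?P = "emeasure M {x \<in> space M. pivot_of_type A (T x) (\<omega> x) v i}"
  let ?J = "\<integral>\<^sup>+c. of_nat (card {k. ptype A (- {root_col c}) c (v @ [k]) = Some j})
      * indicator {c. ptype A (- {root_col c}) c v = Some i} c \<partial>?H"
  have i: "snd i \<noteq> {}"
    using pos occurring_types_iff occurring_types_nonempty by blast
  have "(\<integral>\<^sup>+x. of_nat (card {k. pivot_of_type A (T x) (\<omega> x) (v @ [k]) j}) *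
           indicator {x. pivot_of_type A (T x) (\<omega> x) v i} x \<partial>M)
      = (\<integral>\<^sup>+x. (\<lambda>c. of_nat (card {k. ptype A (- {root_col c}) c (v @ [k]) = Some j})
      * indicator {c. ptype A (- {root_col c}) c v = Some i} c) (coloured (Suc (length v)) x) \<partial>M)"
    using AE_compatible
  proof (intro nn_integral_cong_AE, elim eventually_mono)
    fix x assume comp: "compatible A (T x) (\<omega> x)"
    show "of_nat (card {k. pivot_of_type A (T x) (\<omega> x) (v @ [k]) j}) *
           indicator {x. pivot_of_type A (T x) (\<omega> x) v i} x
      = (\<lambda>c. of_nat (card {k. ptype A (- {root_col c}) c (v @ [k]) = Some j})
      * (indicator {c. ptype A (- {root_col c}) c v = Some i} c :: ennreal)) (coloured (Suc (length v)) x)"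
      using assms(2) i by (simp add: pivot_of_type_iff[OF comp, where n = "Suc (length v)"] indicator_def
          del: ctrunc.simps)
  qed
  then have num: "(\<integral>\<^sup>+x. of_nat (card {k. pivot_of_type A (T x) (\<omega> x) (v @ [k]) j}) *
           indicator {x. pivot_of_type A (T x) (\<omega> x) v i} x \<partial>M) = ?J"
    by (simp only: nn_integral_coloured[of "\<lambda>c. of_nat (card {k. ptype A (- {root_col c}) c (v @ [k]) = Some j})
      * indicator {c. ptype A (- {root_col c}) c v = Some i} c"])
  have P: "?P = emeasure ?H {c. ptype A (- {root_col c}) c v = Some i}"
    by (rule emeasure_pivot) (use i in auto)
  have eq: "ennreal (pmf \<nu> (fst i)) * ?J = type_mean i j * ?P"
    unfolding P by (rule type_mean_vertex[where f = "\<lambda>a. - {a}"])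
  have "mean_children_at A M T \<omega> v i j = ?J / ?P"
    by (simp only: mean_children_at_def num emeasure_eq_measure)
  then have "ennreal (pmf \<nu> (fst i)) * mean_children_at A M T \<omega> v i j = type_mean i j * ?P / ?P"
    by (simp only: ennreal_times_divide eq)
  also have "\<dots> = type_mean i j"
    using pos by (intro ennreal_mult_divide_eq) auto
  finally show "ennreal (pmf \<nu> (fst i)) * mean_children_at A M T \<omega> v i j = type_mean i j" .
  show "j \<in> types" if "type_mean i j > 0"
  proof (rule ccontr)
    assume "j \<notin> types"
    then have "emeasure ?H {c. ptype A (- {root_col c}) c (v @ [k]) = Some j} = 0" for k
      using occurring_types_iff emeasure_pivot[of j "v @ [k]" "Suc (length v)"] assms(2)
      by (simp del: ctree_law.simps)
    then have "AE c in ?H. \<forall>k. \<not> ptype A (- {root_col c}) c (v @ [k]) = Some j"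
      by (subst AE_all_countable) (auto simp: AE_iff_measurable[OF _ refl] simp del: ctree_law.simps)
    then have "?J = (\<integral>\<^sup>+c. 0 \<partial>?H)"
      by (intro nn_integral_cong_AE) (auto elim!: eventually_mono)
    with eq pos that show False
      by (auto simp del: ctree_law.simps)
  qed
qed

lemma mean_children_eq:
  assumes "pmf \<nu> (fst i) \<noteq> 0" "i \<in> types" "snd j \<noteq> {}"
  shows "ennreal (pmf \<nu> (fst i)) * means i j = type_mean i j"
proof -
  obtain v where v: "emeasure M {x \<in> space M. pivot_of_type A (T x) (\<omega> x) v i} > 0"
    using assms(2) occurring_types_iff by blast
  have "\<exists>v. \<P>(x in M. pivot_of_type A (T x) (\<omega> x) v i) > 0"
    using v by (intro exI[of _ v]) (simp add: emeasure_eq_measure)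
  then have "\<P>(x in M. pivot_of_type A (T x) (\<omega> x) (SOME v. \<P>(x in M. pivot_of_type A (T x) (\<omega> x) v i) > 0) i) > 0"
    by (rule someI_ex)
  then show ?thesis
    unfolding mean_children_def
    by (intro type_mean_eq_mean_children_at(1) assms) (simp add: emeasure_eq_measure)
qed

lemma occurring_types_step:
  assumes "pmf \<nu> (fst i) \<noteq> 0" "i \<in> types" "snd j \<noteq> {}" "type_mean i j > 0"
  shows "j \<in> types"
  using assms type_mean_eq_mean_children_at(2) occurring_types_iff by blast

lemma root_type_occurs:
  assumes "pmf \<nu> a \<noteq> 0" "- {a} \<noteq> {}"
  shows "(a, - {a}) \<in> types"
proof -
  have "emeasure M {x \<in> space M. pivot_of_type A (T x) (\<omega> x) [] (a, - {a})}
      = emeasure (ctree_law A chi \<nu> 0) {c. root_col c = a}"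
    using assms(2) by (subst emeasure_pivot[where n = 0]) (auto intro!: arg_cong[where f = "emeasure _"])
  also have "\<dots> = ennreal (pmf \<nu> a)"
    by (simp add: vimage_def emeasure_pmf_single)
  finally show ?thesis
    unfolding occurring_types_iff using assms(1) by (intro exI[of _ "[]"]) (simp add: pmf_pos)
qed

lemma mean_var_le_total_mean:
  assumes full: "\<And>a. pmf \<nu> a \<noteq> 0" and "B \<noteq> {}" "\<And>a. a \<notin> B \<Longrightarrow> (a, B) \<in> types"
  shows "mean_var n B \<le> (\<Sum>a\<in>- B. ennreal (pmf \<nu> a) * total_mean types means n (a, B))"
  using assms(2,3)
proof (induction n arbitrary: B)
  case 0
  have "mean_var 0 B \<le> emeasure \<nu> (- B)"
    by (rule mean_var_0)
  also have "\<dots> = (\<Sum>a\<in>- B. ennreal (pmf \<nu> a))"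
    by (simp add: emeasure_measure_pmf_finite)
  finally show ?case by simp
next
  case (Suc n)
  let ?S = "\<lambda>C. {c. c \<notin> C \<and> (c, C) \<in> types}"
  have "mean_var (Suc n) B \<le> (\<Sum>C\<in>UNIV. pull_mean B C * mean_var n C)"
    by (rule mean_var_Suc)
  also have "\<dots> \<le> (\<Sum>C\<in>UNIV. \<Sum>c\<in>?S C. (\<Sum>a\<in>- B. type_mean (a, B) (c, C)) * total_mean types means n (c, C))"
  proof (rule sum_mono)
    fix C
    show "pull_mean B C * mean_var n C \<le> (\<Sum>c\<in>?S C. (\<Sum>a\<in>- B. type_mean (a, B) (c, C)) * total_mean types means n (c, C))"
    \<comment> \<open>The empty set needs its own case: \<open>(c, {})\<close> is never the type of
      a pivotal vertex, but the variance of \<open>{}\<close> vanishes.\<close>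
    proof (cases "C = {} \<or> pull_mean B C = 0")
      case True
      then have "pull_mean B C * mean_var n C = 0"
        by (elim disjE) simp_all
      then show ?thesis by (simp only: zero_le)
    next
      case False
      have occ: "(c, C) \<in> types" if "c \<notin> C" for c
      proof -
        \<comment> \<open>Here full support enters: with \<open>pmf \<nu> c > 0\<close>, a nonzero
          coefficient gives some \<open>a \<notin> B\<close> with a positive mean towards
          \<open>(c, C)\<close>.\<close>
        have "(\<Sum>a\<in>- B. type_mean (a, B) (c, C)) \<noteq> 0"
          using False full[of c] by (simp add: sum_type_mean[OF that])
        then obtain a where a: "a \<in> - B" "type_mean (a, B) (c, C) \<noteq> 0"
          by (rule sum.not_neutral_contains_not_neutral)
        have "(a, B) \<in> types"
          using a(1) Suc.prems(2) by simp
        then show ?thesis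
          by (rule occurring_types_step[rotated]) (use a(2) False full in \<open>simp_all add: zero_less_iff_neq_zero\<close>)
      qed
      then have S: "?S C = - C"
        by auto
      have "mean_var n C \<le> (\<Sum>c\<in>- C. ennreal (pmf \<nu> c) * total_mean types means n (c, C))"
        using False occ by (intro Suc.IH) auto
      then have "pull_mean B C * mean_var n C \<le> pull_mean B C * (\<Sum>c\<in>- C. ennreal (pmf \<nu> c) * total_mean types means n (c, C))"
        by (rule mult_left_mono) simp
      also have "\<dots> = (\<Sum>c\<in>- C. (\<Sum>a\<in>- B. type_mean (a, B) (c, C)) * total_mean types means n (c, C))"
        by (simp add: sum_type_mean sum_distrib_left mult.assoc)
      finally show ?thesis
        unfolding S .
    qed
  qed
  also have "\<dots> = (\<Sum>C\<in>UNIV. \<Sum>c\<in>?S C. \<Sum>a\<in>- B. type_mean (a, B) (c, C) * total_mean types means n (c, C))"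
    by (simp add: sum_distrib_right)
  also have "\<dots> = (\<Sum>(C, c)\<in>(SIGMA C:UNIV. ?S C). \<Sum>a\<in>- B. type_mean (a, B) (c, C) * total_mean types means n (c, C))"
    by (subst sum.Sigma) auto
  also have "\<dots> = (\<Sum>j\<in>{j\<in>types. fst j \<notin> snd j}. \<Sum>a\<in>- B. type_mean (a, B) j * total_mean types means n j)"
    by (rule sum.reindex_bij_witness[where i = prod.swap and j = prod.swap]) auto
  \<comment> \<open>Extending the sum to all occurring types, as \<open>total_mean\<close> demands,
    only adds nonnegative terms.\<close>
  also have "\<dots> \<le> (\<Sum>j\<in>types. \<Sum>a\<in>- B. type_mean (a, B) j * total_mean types means n j)"
    by (rule sum_mono2) auto
  also have "\<dots> = (\<Sum>a\<in>- B. \<Sum>j\<in>types. type_mean (a, B) j * total_mean types means n j)"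
    by (rule sum.swap)
  also have "\<dots> = (\<Sum>a\<in>- B. ennreal (pmf \<nu> a) * total_mean types means (Suc n) (a, B))"
  proof (rule sum.cong[OF refl])
    fix a assume "a \<in> - B"
    then have "(a, B) \<in> types"
      using Suc.prems(2) by simp
    then have "type_mean (a, B) j = ennreal (pmf \<nu> a) * means (a, B) j" if "j \<in> types" for j
      using mean_children_eq[of "(a, B)" j] full occurring_types_nonempty[OF that] by simp
    then show "(\<Sum>j\<in>types. type_mean (a, B) j * total_mean types means n j) = ennreal (pmf \<nu> a) * total_mean types means (Suc n) (a, B)"
      by (simp add: sum_distrib_left mult.assoc)
  qed
  finally show ?case .
qed

end

section \<open>Geometric decay\<close>

text \<open>Scaling the matrix by some \<open>c > 1\<close> that keeps the spectral radius below 1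
  leaves all powers bounded, so the unscaled powers decay like \<open>(1 / c) ^ n\<close>. The slack
  in \<open>c\<close> absorbs the polynomial factors that Jordan blocks may cause at the exact
  rate.\<close>

lemma total_mean_le_geometric:
  assumes fin: "finite I" and sr: "spectral_radius_on I m < 1"
  shows "\<exists>C r. 0 \<le> C \<and> 0 \<le> r \<and> r < 1 \<and> (\<forall>n. \<forall>i\<in>I. total_mean I m n i \<le> ennreal (C * r ^ n))"
proof (cases "I = {}")
  case True
  then show ?thesis by (intro exI[of _ 0]) simp
next
  case False
  have m: "m i j \<noteq> \<infinity>" if "i \<in> I" "j \<in> I" for i j
    using sr that by (auto simp: spectral_radius_on_def split: if_splits)
  define xs where "xs = (SOME xs. distinct xs \<and> set xs = I)"
  have xs: "distinct xs" "set xs = I"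
    using someI_ex[of "\<lambda>xs. distinct xs \<and> set xs = I"] finite_distinct_list[OF fin] by (auto simp: xs_def)
  define N where "N = length xs"
  have N: "N > 0"
    using xs False by (auto simp: N_def)
  define p where "p a b = enn2real (m (xs ! a) (xs ! b))" for a b
  define P where "P = Matrix.mat N N (\<lambda>(a, b). complex_of_real (p a b))"
  have P: "P \<in> carrier_mat N N"
    by (simp add: P_def)
  define \<rho> where "\<rho> = spectral_radius P"
  have \<rho>0: "0 \<le> \<rho>"
    using spectral_radius_mem_max(1)[OF P N] by (auto simp: \<rho>_def)
  have "spectral_radius_on I m = ennreal \<rho>"
    using m unfolding spectral_radius_on_def \<rho>_def P_def p_def N_def xs_def Let_def by auto
  with sr have \<rho>1: "\<rho> < 1"
    by (simp add: ennreal_less_iff[OF \<rho>0] flip: ennreal_1)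
  \<comment> \<open>Any number above 1 whose product with \<open>\<rho>\<close> is below 1 would
    serve; this formula also covers \<open>\<rho> = 0\<close>.\<close>
  define c where "c = 2 / (1 + \<rho>)"
  have c: "c > 1" "c * \<rho> < 1"
    using \<rho>0 \<rho>1 by (auto simp: c_def field_simps)
  define Q where "Q = complex_of_real c \<cdot>\<^sub>m P"
  have Q: "Q \<in> carrier_mat N N"
    using P by (simp add: Q_def)
  have "spectral_radius Q < 1"
  proof -
    obtain k where k: "k \<in> spectrum Q" "spectral_radius Q = norm k"
      using spectral_radius_mem_max(1)[OF Q N] by auto
    then obtain v where v: "v \<in> carrier_vec N" "v \<noteq> 0\<^sub>v N" "Q *\<^sub>v v = k \<cdot>\<^sub>v v"
      using Q by (auto simp: spectrum_def eigenvalue_def eigenvector_def)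
    have "P *\<^sub>v v = (k / complex_of_real c) \<cdot>\<^sub>v v"
    proof (rule eq_vecI)
      fix a assume "a < dim_vec ((k / complex_of_real c) \<cdot>\<^sub>v v)"
      then have a: "a < N" using v by simp
      have "complex_of_real c * (P *\<^sub>v v) $ a = (Q *\<^sub>v v) $ a"
        using a P v(1) by (simp add: Q_def)
      also have "\<dots> = k * v $ a"
        using a v by simp
      finally show "(P *\<^sub>v v) $ a = ((k / complex_of_real c) \<cdot>\<^sub>v v) $ a"
        using a v(1) c by (simp add: field_simps)
    qed (use P v in simp)
    then have "k / complex_of_real c \<in> spectrum P"
      using P v by (auto simp: spectrum_def eigenvalue_def eigenvector_def)
    then have "norm (k / complex_of_real c) \<le> \<rho>"
      unfolding \<rho>_def by (intro spectral_radius_mem_max(2)[OF P N]) simp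
    then have "norm k \<le> c * \<rho>"
      using c by (simp add: norm_divide field_simps)
    then show ?thesis
      using k c by simp
  qed
  then obtain b where b: "norm_bound (Q ^\<^sub>m n) b" for n
    using spectral_radius_jnf_norm_bound_less_1_upper_triangular[OF Q] by blast
  define u where "u n a = enn2real (total_mean I m n (xs ! a))" for n a
  have fin_tm: "total_mean I m n i \<noteq> \<infinity>" if "i \<in> I" for n i
    using that
    by (induction n arbitrary: i) (auto simp: fin m[unfolded infinity_ennreal_def] ennreal_mult_eq_top_iff)
  have u: "total_mean I m n (xs ! a) = ennreal (u n a)" if "a < N" for n a
    using fin_tm[of "xs ! a" n] xs that by (auto simp: u_def N_def less_top)
  have u_Suc: "u (Suc n) a = (\<Sum>d<N. p a d * u n d)" if "a < N" for n a
  proof -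
    have bij: "bij_betw ((!) xs) {..<N} I"
      using bij_betw_nth[OF xs(1), of "{..<N}" I] xs by (simp add: N_def)
    have "total_mean I m (Suc n) (xs ! a) = (\<Sum>d<N. m (xs ! a) (xs ! d) * total_mean I m n (xs ! d))"
      by (simp add: sum.reindex_bij_betw[OF bij, symmetric])
    also have "\<dots> = (\<Sum>d<N. ennreal (p a d * u n d))"
    proof (rule sum.cong[OF refl])
      fix d assume "d \<in> {..<N}"
      then have "m (xs ! a) (xs ! d) = ennreal (p a d)"
        using m[of "xs ! a" "xs ! d"] that xs by (auto simp: p_def N_def less_top)
      then show "m (xs ! a) (xs ! d) * total_mean I m n (xs ! d) = ennreal (p a d * u n d)"
        using u \<open>d \<in> {..<N}\<close> by (simp add: ennreal_mult p_def u_def)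
    qed
    also have "\<dots> = ennreal (\<Sum>d<N. p a d * u n d)"
      by (intro sum_ennreal) (simp add: p_def u_def)
    finally show ?thesis
      by (simp add: u_def p_def sum_nonneg)
  qed
  \<comment> \<open>Scaled by \<open>c ^ n\<close>, so that one generation is one application of
    \<open>Q\<close>; \<open>V 0\<close> is the all-ones vector.\<close>
  define V where "V n = Matrix.vec N (\<lambda>a. complex_of_real (c ^ n * u n a))" for n
  have V: "V n \<in> carrier_vec N" for n
    by (simp add: V_def)
  have V_Suc: "V (Suc n) = Q *\<^sub>v V n" for n
  proof (rule eq_vecI)
    fix a assume "a < dim_vec (Q *\<^sub>v V n)"
    then have a: "a < N" using Q by simp
    have "(Q *\<^sub>v V n) $ a = (\<Sum>d<N. complex_of_real c * complex_of_real (p a d) * complex_of_real (c ^ n * u n d))"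
      using a by (simp add: Q_def P_def V_def scalar_prod_def lessThan_atLeast0)
    also have "\<dots> = complex_of_real (c ^ Suc n * (\<Sum>d<N. p a d * u n d))"
      by (simp add: sum_distrib_left mult_ac)
    finally show "V (Suc n) $ a = (Q *\<^sub>v V n) $ a"
      using a by (simp add: V_def u_Suc)
  qed (use Q V in simp)
  have pow: "Q ^\<^sub>m n *\<^sub>v V k = V (n + k)" for n k
  proof (induction n arbitrary: k)
    case 0
    then show ?case using Q V[of k] by simp
  next
    case (Suc n)
    have "Q ^\<^sub>m Suc n *\<^sub>v V k = Q ^\<^sub>m n *\<^sub>v (Q *\<^sub>v V k)"
      using Q V[of k] by (simp add: assoc_mult_mat_vec[OF pow_carrier_mat[OF Q] Q])
    then show ?case
      using Suc.IH[of "Suc k"] by (simp add: V_Suc)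
  qed
  have bound: "c ^ n * u n a \<le> real N * b" if a: "a < N" for n a
  proof -
    have "complex_of_real (c ^ n * u n a) = (Q ^\<^sub>m n *\<^sub>v V 0) $ a"
      using a pow[of n 0] by (simp add: V_def)
    also have "\<dots> = (\<Sum>d<N. (Q ^\<^sub>m n) $$ (a, d))"
      using a carrier_matD[OF pow_carrier_mat[OF Q, of n]]
      by (simp add: V_def scalar_prod_def lessThan_atLeast0 u_def)
    finally have "norm (complex_of_real (c ^ n * u n a)) \<le> (\<Sum>d<N. norm ((Q ^\<^sub>m n) $$ (a, d)))"
      using norm_sum by metis
    also have "\<dots> \<le> (\<Sum>d<N. b)"
      using b[of n] a carrier_matD[OF Q] by (intro sum_mono) (auto simp: norm_bound_def)
    finally show ?thesis
      using c by (simp add: norm_mult norm_power u_def abs_of_pos)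
  qed
  have "total_mean I m n i \<le> ennreal (real N * b * (1 / c) ^ n)" if "i \<in> I" for n i
  proof -
    obtain a where a: "a < N" "i = xs ! a"
      using \<open>i \<in> I\<close> xs by (auto simp: in_set_conv_nth N_def)
    have "u n a \<le> real N * b * (1 / c) ^ n"
      using bound[OF a(1), of n] c by (simp add: field_simps power_divide)
    then show ?thesis
      unfolding a(2) u[OF a(1)] by (rule ennreal_leI)
  qed
  moreover have "0 \<le> real N * b"
    using bound[OF N, of 0] by (simp add: u_def)
  ultimately show ?thesis
    using c by (intro exI[of _ "real N * b"] exI[of _ "1 / c"]) auto
qed

section \<open>Trees that determine the state of their root\<close>

lemma seq_pmf_map_Pair: "seq_pmf (map (\<lambda>x. map_pmf (Pair x) (f x)) xs) = map_pmf (zip xs) (seq_pmf (map f xs))"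
proof (induction xs)
  case (Cons x xs)
  show ?case
    by (simp add: Cons.IH map_bind_pmf bind_map_pmf map_pmf_comp)
qed simp

text \<open>The left side is the variance of an indicator with mean \<open>pmf q \<sigma>\<close>.
  This lets \<open>mean_var\<close> be read as a mean square distance to a point mass.\<close>

lemma nn_integral_square_deviation:
  "(\<integral>\<^sup>+s. ennreal ((pmf q \<sigma> - indicator {\<sigma>} s)\<^sup>2) \<partial>measure_pmf q) = ennreal (bernoulli_var q {\<sigma>})"
proof -
  let ?p = "pmf q \<sigma>"
  have sq: "(?p - indicator {\<sigma>} s)\<^sup>2 = ?p\<^sup>2 + (1 - 2 * ?p) * indicator {\<sigma>} s" for s
    by (simp add: indicator_def power2_eq_square algebra_simps)
  have [simp]: "integrable (measure_pmf q) (indicator {\<sigma>} :: _ \<Rightarrow> real)"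
    by (rule integrable_pmf_bounded[where c = 1]) (auto simp: indicator_def)
  have "measure_pmf.expectation q (\<lambda>s. (?p - indicator {\<sigma>} s)\<^sup>2) = ?p\<^sup>2 + (1 - 2 * ?p) * ?p"
    unfolding sq by (subst Bochner_Integration.integral_add) (simp_all add: measure_pmf_single)
  then have "measure_pmf.expectation q (\<lambda>s. (?p - indicator {\<sigma>} s)\<^sup>2) = bernoulli_var q {\<sigma>}"
    by (simp add: bernoulli_var_def measure_pmf_single power2_eq_square algebra_simps)
  moreover have "(?p - indicator {\<sigma>} s)\<^sup>2 \<le> 1" for s
  proof -
    have "\<bar>?p - indicator {\<sigma>} s\<bar> \<le> 1"
      using pmf_nonneg[of q \<sigma>] pmf_le_1[of q \<sigma>] by (auto simp: indicator_def)
    then show ?thesis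
      by (simp only: abs_square_le_1)
  qed
  ultimately show ?thesis
    using ennreal_expectation[of "\<lambda>s. (?p - indicator {\<sigma>} s)\<^sup>2" 1 q] by simp
qed

lemma pmf_le_pmf_map: "pmf p x \<le> pmf (map_pmf f p) (f x)"
proof -
  have "measure_pmf.prob p {x} \<le> measure_pmf.prob p (f -` {f x})"
    by (intro measure_pmf.finite_measure_mono) auto
  then show ?thesis
    by (simp add: pmf_map measure_pmf_single)
qed

text \<open>All quantifiers range over naturals, so that a set of convergence is a countable
  combination of measurable sets.\<close>

lemma tendsto_iff_Suc:
  fixes X :: "nat \<Rightarrow> real"
  shows "X \<longlonglongrightarrow> L \<longleftrightarrow> (\<forall>k. \<exists>N. \<forall>n\<ge>N. \<bar>X n - L\<bar> < 1 / real (Suc k))"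
proof
  assume "X \<longlonglongrightarrow> L"
  then show "\<forall>k. \<exists>N. \<forall>n\<ge>N. \<bar>X n - L\<bar> < 1 / real (Suc k)"
    using LIMSEQ_iff[of X L] by (auto simp del: of_nat_Suc)
next
  assume *: "\<forall>k. \<exists>N. \<forall>n\<ge>N. \<bar>X n - L\<bar> < 1 / real (Suc k)"
  show "X \<longlonglongrightarrow> L"
  proof (rule LIMSEQ_I)
    fix r :: real assume "0 < r"
    then obtain k where k: "1 / real (Suc k) < r"
      using reals_Archimedean by (auto simp: inverse_eq_divide)
    from * obtain N where "\<forall>n\<ge>N. \<bar>X n - L\<bar> < 1 / real (Suc k)" by blast
    then show "\<exists>no. \<forall>n\<ge>no. norm (X n - L) < r"
      using k by (metis less_trans real_norm_def)
  qed
qed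

section \<open>Trees on which the root law converges to a point mass\<close>

definition resolves :: "'s automaton \<Rightarrow> 's pmf \<Rightarrow> tree \<Rightarrow> 's \<Rightarrow> bool" where
  "resolves A \<nu> t s \<longleftrightarrow> (\<lambda>n. pmf (root_law A \<nu> n t) s) \<longlonglongrightarrow> 1"

text \<open>Trees without a limiting state all share the one default value
  \<open>THE s. False\<close>; \<open>measurable_resolved_state\<close> relies on this.\<close>

definition resolved_state :: "'s automaton \<Rightarrow> 's pmf \<Rightarrow> tree \<Rightarrow> 's" where
  "resolved_state A \<nu> t = (THE s. resolves A \<nu> t s)"

lemma resolves_unique:
  assumes "resolves A \<nu> t s" "resolves A \<nu> t s'"
  shows "s = s'"
proof (rule ccontr)
  assume "s \<noteq> s'"
  have "pmf (root_law A \<nu> n t) s + pmf (root_law A \<nu> n t) s' \<le> 1" for n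
  proof -
    have "measure_pmf.prob (root_law A \<nu> n t) {s, s'} \<le> 1" by simp
    then show ?thesis
      using \<open>s \<noteq> s'\<close> by (simp add: measure_measure_pmf_finite)
  qed
  moreover have "(\<lambda>n. pmf (root_law A \<nu> n t) s + pmf (root_law A \<nu> n t) s') \<longlonglongrightarrow> 1 + 1"
    using assms unfolding resolves_def by (rule tendsto_add)
  ultimately show False
    using LIMSEQ_le_const2[of _ "1 + 1 :: real" 1] by fastforce
qed

lemma resolved_state_eq: "resolves A \<nu> t s \<Longrightarrow> resolved_state A \<nu> t = s"
  unfolding resolved_state_def by (rule the_equality) (auto intro: resolves_unique)

text \<open>If every child \<open>i\<close> is in state \<open>f i\<close>, then the state of the
  parent is determined, so its probability is at least a product of finitely many factors that tend
  to 1.\<close>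

lemma resolves_parent:
  assumes "\<And>i. i < length (children t) \<Longrightarrow> resolves A \<nu> (children t ! i) (f i)"
  shows "resolves A \<nu> t (A (count_list (map f [0..<length (children t)])))"
proof -
  let ?k = "length (children t)" and ?s = "map f [0..<length (children t)]"
  let ?q = "\<lambda>n. root_law A \<nu> n"
  have "(\<lambda>n. pmf (?q (Suc n) t) (A (count_list ?s))) \<longlonglongrightarrow> 1"
  proof (rule tendsto_sandwich[where h = "\<lambda>_. 1"])
    show "(\<lambda>n. \<Prod>i<?k. pmf (?q n (children t ! i)) (f i)) \<longlonglongrightarrow> 1"
      using tendsto_prod[of "{..<?k}" "\<lambda>i n. pmf (?q n (children t ! i)) (f i)" "\<lambda>_. 1" sequentially] assms
      by (simp add: resolves_def)
    show "\<forall>\<^sub>F n in sequentially. (\<Prod>i<?k. pmf (?q n (children t ! i)) (f i)) \<le> pmf (?q (Suc n) t) (A (count_list ?s))"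
    proof (rule always_eventually, rule allI)
      fix n
      have "(\<Prod>i<?k. pmf (?q n (children t ! i)) (f i)) = pmf (seq_pmf (map (?q n) (children t))) ?s"
        by (simp add: pmf_seq_pmf)
      also have "\<dots> \<le> pmf (?q (Suc n) t) (A (count_list ?s))"
        using pmf_le_pmf_map[of "seq_pmf (map (?q n) (children t))" ?s "\<lambda>s. A (count_list s)"] by simp
      finally show "(\<Prod>i<?k. pmf (?q n (children t ! i)) (f i)) \<le> pmf (?q (Suc n) t) (A (count_list ?s))" .
    qed
  qed (simp_all add: pmf_le_1 del: root_law.simps)
  then show ?thesis
    unfolding resolves_def by (rule LIMSEQ_imp_Suc)
qed

lemma sets_resolves: "{t. resolves A \<nu> t s} \<in> sets tree_space"
proof -
  have [measurable]: "(\<lambda>t. pmf (root_law A \<nu> n t) s) \<in> borel_measurable tree_space" for n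
    by (rule measurable_truncate_determined[where n = n]) (metis root_law_truncate, simp)
  have "{t \<in> space tree_space. \<forall>k. \<exists>N. \<forall>n\<ge>N. \<bar>pmf (root_law A \<nu> n t) s - 1\<bar> < 1 / real (Suc k)} \<in> sets tree_space"
    by measurable
  then show ?thesis
    by (simp add: resolves_def tendsto_iff_Suc)
qed

lemma measurable_resolved_state:
  "resolved_state A \<nu> \<in> tree_space \<rightarrow>\<^sub>M count_space (UNIV :: ('s::finite) set)"
proof (subst measurable_count_space_eq_countable)
  have "resolved_state A \<nu> -` {s} \<inter> space tree_space \<in> sets tree_space" for s
  proof -
    let ?L = "\<lambda>s. {t. resolves A \<nu> t s}"
    have "resolved_state A \<nu> -` {s} \<inter> space tree_space
        = ?L s \<union> ((- (\<Union>s\<in>UNIV. ?L s)) \<inter> {t. (THE s::'s. False) = s})"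
    proof (rule Set.set_eqI)
      fix t
      show "t \<in> resolved_state A \<nu> -` {s} \<inter> space tree_space \<longleftrightarrow>
          t \<in> ?L s \<union> ((- (\<Union>s\<in>UNIV. ?L s)) \<inter> {t. (THE s::'s. False) = s})"
      proof (cases "\<exists>s. resolves A \<nu> t s")
        case True
        then obtain s' where s': "resolves A \<nu> t s'" by blast
        then show ?thesis
          using resolved_state_eq[OF s'] resolves_unique by auto
      next
        case False
        then show ?thesis
          by (simp add: resolved_state_def)
      qed
    qed
    also have "\<dots> \<in> sets tree_space"
    proof -
      have "- (\<Union>s\<in>UNIV. ?L s) = space tree_space - (\<Union>s\<in>UNIV. ?L s)"
        by auto
      also have "\<dots> \<in> sets tree_space"
        by (intro sets.Diff sets.top sets.finite_UN sets_resolves) auto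
      finally show ?thesis
        using sets_resolves[of A \<nu> s] by (cases "(THE s::'s. False) = s") auto
    qed
    finally show ?thesis .
  qed
  then show "resolved_state A \<nu> \<in> space tree_space \<rightarrow> UNIV \<and>
      (\<forall>a\<in>UNIV. resolved_state A \<nu> -` {a} \<inter> space tree_space \<in> sets tree_space)"
    by auto
qed auto

section \<open>From almost every tree to all of its subtrees\<close>

lemma truncate_subtree:
  assumes "truncate_tree (n + length v) t = truncate_tree (n + length v) t'" "v \<in> vertices t"
  shows "truncate_tree n (subtree t v) = truncate_tree n (subtree t' v)"
  using assms
proof (induction v arbitrary: t t')
  case (Cons i v)
  have "map (truncate_tree (n + length v)) (children t) = map (truncate_tree (n + length v)) (children t')"
    using Cons.prems(1) by simp
  then have "i < length (children t')" "truncate_tree (n + length v) (children t ! i) = truncate_tree (n + length v) (children t' ! i)"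
    using Cons.prems(2) by (auto simp: map_eq_map_iff)
  then show ?case
    using Cons.IH Cons.prems(2) by simp
qed simp

lemma sets_vertex_subtree:
  assumes "S \<in> sets tree_space"
  shows "{t. v \<in> vertices t \<longrightarrow> subtree t v \<in> S} \<in> sets tree_space"
proof -
  \<comment> \<open>Off the vertices of \<open>t\<close>, \<open>subtree t v\<close> has no meaning;
    with a fixed tree in its place, \<open>n\<close> generations of \<open>g t\<close> are
    determined by \<open>n + length v\<close> generations of \<open>t\<close>.\<close>
  define g where "g t = (if v \<in> vertices t then subtree t v else Node [])" for t
  have det: "truncate_tree n (g t) = truncate_tree n (g t')"
    if "truncate_tree (n + length v) t = truncate_tree (n + length v) t'" for n t t'
    using truncate_subtree[OF that] vertices_cong[OF that, of v] by (simp add: g_def)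
  have meas: "(\<lambda>t. truncate_tree n (g t)) \<in> tree_space \<rightarrow>\<^sub>M count_space UNIV" for n
    by (rule measurable_truncate_determined[where n = "n + length v"]) (rule det, simp_all)
  have "g \<in> tree_space \<rightarrow>\<^sub>M sigma UNIV {{t'. truncate_tree n t' = truncate_tree n t} | n t. True}"
  proof (rule measurable_measure_of)
    fix y assume "y \<in> {{t'. truncate_tree n t' = truncate_tree n t} | n t. True}"
    then obtain n t where y: "y = {t'. truncate_tree n t' = truncate_tree n t}" by auto
    show "g -` y \<inter> space tree_space \<in> sets tree_space"
      using measurable_sets[OF meas[of n], of "{truncate_tree n t}"] by (simp add: y vimage_def)
  qed auto
  then have g: "g \<in> tree_space \<rightarrow>\<^sub>M tree_space"
    unfolding tree_space_def .
  have V: "{t. v \<in> vertices t} \<in> sets tree_space"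
  proof -
    have "(\<lambda>t. v \<in> vertices t) \<in> tree_space \<rightarrow>\<^sub>M count_space UNIV"
      by (rule measurable_truncate_determined[where n = "length v"]) (auto dest: vertices_cong)
    from measurable_sets[OF this, of "{True}"] show ?thesis
      by (simp add: vimage_def)
  qed
  have "{t. v \<in> vertices t \<longrightarrow> subtree t v \<in> S} = (space tree_space - {t. v \<in> vertices t}) \<union> (g -` S \<inter> space tree_space)"
    by (auto simp: g_def split: if_splits)
  also have "\<dots> \<in> sets tree_space"
    by (intro sets.Un sets.Diff sets.top V measurable_sets[OF g assms])
  finally show ?thesis .
qed

lemma subtree_tree_of_counts:
  "v \<in> vertices (tree_of_counts k) \<Longrightarrow> subtree (tree_of_counts k) v = tree_of_counts (\<lambda>u. k (v @ u))"
  by (induction v arbitrary: k) auto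

text \<open>Child counts are attached to all addresses, so the field seen from \<open>v\<close> is
  again i.i.d. with law \<open>chi\<close>, whether or not \<open>v\<close> belongs to the tree. A
  union over the countably many addresses finishes the proof.\<close>

lemma AE_GW_subtrees:
  assumes S: "S \<in> sets tree_space" and AE: "AE t in GW chi. t \<in> S"
  shows "AE t in GW chi. \<forall>v\<in>vertices t. subtree t v \<in> S"
proof -
  have "AE t in GW chi. v \<in> vertices t \<longrightarrow> subtree t v \<in> S" for v
  proof -
    have root: "AE k in counts chi. tree_of_counts k \<in> S"
      using AE S unfolding GW_def by (subst (asm) AE_distr_iff) auto
    have shift: "distr (counts chi) (counts chi) (\<lambda>k u. k (v @ u)) = counts chi"
      using distr_PiM_reindex[of UNIV "\<lambda>_. measure_pmf chi" "(@) v" UNIV]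
      by (simp add: measure_pmf.prob_space_axioms inj_def restrict_def)
    have [measurable]: "(\<lambda>k u. k (v @ u)) \<in> counts chi \<rightarrow>\<^sub>M counts chi"
      by (rule measurable_PiM_single') auto
    have "AE k in distr (counts chi) (counts chi) (\<lambda>k u. k (v @ u)). tree_of_counts k \<in> S"
      unfolding shift by (rule root)
    then have "AE k in counts chi. tree_of_counts (\<lambda>u. k (v @ u)) \<in> S"
      using S by (subst (asm) AE_distr_iff) auto
    then have "AE k in counts chi. v \<in> vertices (tree_of_counts k) \<longrightarrow> subtree (tree_of_counts k) v \<in> S"
      by (auto simp: subtree_tree_of_counts elim!: eventually_mono)
    then show ?thesis
      unfolding GW_def using sets_vertex_subtree[OF S, of v] by (subst AE_distr_iff) auto
  qed
  then have "AE t in GW chi. \<forall>v. v \<in> vertices t \<longrightarrow> subtree t v \<in> S"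
    by (simp add: AE_all_countable)
  then show ?thesis
    by (auto elim!: eventually_mono)
qed

lemma children_subtree: "v \<in> vertices t \<Longrightarrow> i < num_children t v \<Longrightarrow> children (subtree t v) ! i = subtree t (v @ [i])"
  by (induction v arbitrary: t) auto

lemma compatible_resolved_state:
  assumes "\<forall>v\<in>vertices t. \<exists>s. resolves A \<nu> (subtree t v) s"
  shows "compatible A t (\<lambda>v. resolved_state A \<nu> (subtree t v))"
  unfolding compatible_def
proof
  fix v assume v: "v \<in> vertices t"
  let ?f = "\<lambda>i. resolved_state A \<nu> (subtree t (v @ [i]))"
  have "resolves A \<nu> (subtree t v) (A (count_list (map ?f [0..<length (children (subtree t v))])))"
  proof (rule resolves_parent)
    fix i assume i: "i < length (children (subtree t v))"
    then have "v @ [i] \<in> vertices t"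
      using v by (simp add: num_children_def)
    then obtain s where "resolves A \<nu> (subtree t (v @ [i])) s"
      using assms by blast
    then show "resolves A \<nu> (children (subtree t v) ! i) (?f i)"
      using i v by (simp add: children_subtree num_children_def resolved_state_eq)
  qed
  then show "resolved_state A \<nu> (subtree t v) = parent_state A t (\<lambda>v. resolved_state A \<nu> (subtree t v)) v"
    by (simp add: resolved_state_eq parent_state_def card_eq_count_list num_children_def)
qed

text \<open>Identifies \<open>root_law\<close> as the conditional law of the root colour given the
  truncated tree: both sides obey the same recursion over the children.\<close>

lemma (in fixed_point) shape_root_law:
  "map_pmf (\<lambda>c. (shape c, root_col c)) (ctree_law A chi \<nu> n)
    = bind_pmf (gw_trunc chi n) (\<lambda>t. map_pmf (Pair t) (root_law A \<nu> n t))"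
proof (induction n)
  case 0
  then show ?case by (simp add: map_pmf_comp bind_return_pmf)
next
  case (Suc n)
  let ?G = "gw_trunc chi n" and ?q = "root_law A \<nu> n"
  let ?J = "\<lambda>zs. (Node (map fst zs), state (map snd zs))"
  have "map_pmf (\<lambda>c. (shape c, root_col c)) (ctree_law A chi \<nu> (Suc n))
      = bind_pmf chi (\<lambda>k. map_pmf ?J (map_pmf (map (\<lambda>c. (shape c, root_col c))) (replicate_pmf k (ctree_law A chi \<nu> n))))"
    by (simp add: map_bind_pmf map_pmf_comp o_def)
  also have "\<dots> = bind_pmf chi (\<lambda>k. bind_pmf (replicate_pmf k ?G) (\<lambda>ts. map_pmf ?J (map_pmf (zip ts) (seq_pmf (map ?q ts)))))"
    by (simp only: map_replicate_pmf Suc.IH bind_replicate_pmf_seq[symmetric] seq_pmf_map_Pair map_bind_pmf)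
  also have "\<dots> = bind_pmf chi (\<lambda>k. bind_pmf (replicate_pmf k ?G) (\<lambda>ts. map_pmf (\<lambda>s. (Node ts, state s)) (seq_pmf (map ?q ts))))"
    by (intro bind_pmf_cong refl)
      (auto simp: map_pmf_comp dest!: length_seq_pmf intro!: map_pmf_cong)
  also have "\<dots> = bind_pmf (gw_trunc chi (Suc n)) (\<lambda>t. map_pmf (Pair t) (root_law A \<nu> (Suc n) t))"
    by (simp add: bind_assoc_pmf bind_map_pmf map_pmf_comp)
  finally show ?case .
qed

section \<open>Convergence on the random state tree and the resulting interpretation\<close>

context state_tree
begin

lemma nn_integral_root_deviation:
  "(\<integral>\<^sup>+x. ennreal ((pmf (root_law A \<nu> n (T x)) \<sigma> - indicator {\<sigma>} (\<omega> x []))\<^sup>2) \<partial>M) = mean_var n {\<sigma>}"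
proof -
  let ?f = "\<lambda>(t, s). ennreal ((pmf (root_law A \<nu> n t) \<sigma> - indicator {\<sigma>} s)\<^sup>2)"
  have "(\<integral>\<^sup>+x. ennreal ((pmf (root_law A \<nu> n (T x)) \<sigma> - indicator {\<sigma>} (\<omega> x []))\<^sup>2) \<partial>M)
      = (\<integral>\<^sup>+x. (\<lambda>c. ?f (shape c, root_col c)) (coloured n x) \<partial>M)"
    by (simp add: root_law_truncate)
  also have "\<dots> = (\<integral>\<^sup>+c. ?f (shape c, root_col c) \<partial>ctree_law A chi \<nu> n)"
    by (rule nn_integral_coloured)
  also have "\<dots> = (\<integral>\<^sup>+z. ?f z \<partial>map_pmf (\<lambda>c. (shape c, root_col c)) (ctree_law A chi \<nu> n))"
    by simp
  also have "\<dots> = mean_var n {\<sigma>}"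
    unfolding shape_root_law by (simp add: nn_integral_square_deviation mean_var_def)
  finally show ?thesis .
qed

text \<open>The squared deviations have a finite expected sum, so almost surely they are summable
  and tend to 0. Where the root has colour \<open>\<sigma>\<close> the indicator is 1, so the
  probabilities tend to 1.\<close>

lemma AE_resolves:
  assumes "(\<Sum>n. mean_var n {\<sigma>}) < \<infinity>"
  shows "AE x in M. \<omega> x [] = \<sigma> \<longrightarrow> resolves A \<nu> (T x) \<sigma>"
proof -
  define d where "d n x = pmf (root_law A \<nu> n (T x)) \<sigma> - indicator {\<sigma>} (\<omega> x [])" for n x
  have meas: "(\<lambda>x. ennreal ((d n x)\<^sup>2)) \<in> borel_measurable M" for n
  proof -
    have "(\<lambda>x. ennreal ((d n x)\<^sup>2)) = (\<lambda>c. ennreal ((pmf (root_law A \<nu> n (shape c)) \<sigma> - indicator {\<sigma>} (root_col c))\<^sup>2)) \<circ> coloured n"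
      by (simp add: d_def root_law_truncate fun_eq_iff)
    also have "\<dots> \<in> borel_measurable M"
      by (rule measurable_comp[OF measurable_coloured]) simp
    finally show ?thesis .
  qed
  have "(\<integral>\<^sup>+x. (\<Sum>n. ennreal ((d n x)\<^sup>2)) \<partial>M) = (\<Sum>n. mean_var n {\<sigma>})"
    unfolding nn_integral_root_deviation[symmetric] d_def[symmetric] by (rule nn_integral_suminf[OF meas])
  with assms have "AE x in M. (\<Sum>n. ennreal ((d n x)\<^sup>2)) \<noteq> \<infinity>"
    by (intro nn_integral_PInf_AE) (use meas in auto)
  then show ?thesis
  proof eventually_elim
    case (elim x)
    show ?case
    proof
      assume "\<omega> x [] = \<sigma>"
      have "summable (\<lambda>n. (d n x)\<^sup>2)"
        using elim by (intro summable_suminf_not_top) auto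
      then have "(\<lambda>n. (d n x)\<^sup>2) \<longlonglongrightarrow> 0"
        by (rule summable_LIMSEQ_zero)
      then have "(\<lambda>n. sqrt ((d n x)\<^sup>2)) \<longlonglongrightarrow> sqrt 0"
        by (rule tendsto_real_sqrt)
      then have "(\<lambda>n. d n x) \<longlonglongrightarrow> 0"
        by (simp add: tendsto_rabs_zero_iff)
      then show "resolves A \<nu> (T x) \<sigma>"
        using \<open>\<omega> x [] = \<sigma>\<close> by (simp add: resolves_def d_def LIM_zero_iff)
    qed
  qed
qed

lemma emeasure_root_colour: "emeasure M {x \<in> space M. \<omega> x [] = \<sigma>} = ennreal (pmf \<nu> \<sigma>)"
proof -
  have "{x \<in> space M. \<omega> x [] = \<sigma>} \<in> sets M"
    using sets_colour[of "[]" \<sigma>] by simp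
  then have "emeasure M {x \<in> space M. \<omega> x [] = \<sigma>} = (\<integral>\<^sup>+x. indicator {x \<in> space M. \<omega> x [] = \<sigma>} x \<partial>M)"
    by simp
  also have "\<dots> = (\<integral>\<^sup>+x. indicator {c. root_col c = \<sigma>} (coloured 0 x) \<partial>M)"
    by (intro nn_integral_cong) (auto simp: indicator_def)
  also have "\<dots> = emeasure (ctree_law A chi \<nu> 0) {c. root_col c = \<sigma>}"
    unfolding nn_integral_coloured by (rule nn_integral_indicator) simp
  also have "\<dots> = ennreal (pmf \<nu> \<sigma>)"
    by (simp add: vimage_def emeasure_pmf_single)
  finally show ?thesis .
qed

text \<open>Having a limiting state is a property of the tree alone, so it passes from
  \<open>M\<close> to \<open>GW chi\<close> and on to all subtrees, although the colouring is
  compared with the limit only at the root. That comparison yields the law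
  \<open>\<nu>\<close>.\<close>

lemma interpretation_if_resolves:
  assumes "AE x in M. resolves A \<nu> (T x) (\<omega> x [])"
  shows "interpretation_of A chi (resolved_state A \<nu>)"
    and "corresponds_to chi (resolved_state A \<nu>) \<nu>"
proof -
  let ?S = "{t. \<exists>s. resolves A \<nu> t s}"
  have "?S = (\<Union>s\<in>UNIV. {t. resolves A \<nu> t s})"
    by auto
  also have "\<dots> \<in> sets tree_space"
    by (intro sets.finite_UN sets_resolves) auto
  finally have S: "?S \<in> sets tree_space" .
  have "AE x in M. T x \<in> ?S"
    using assms by (auto elim!: eventually_mono)
  then have "AE t in GW chi. t \<in> ?S"
    unfolding distr_T[symmetric] using S by (subst AE_distr_iff) auto
  from AE_GW_subtrees[OF S this] show "interpretation_of A chi (resolved_state A \<nu>)"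
    unfolding interpretation_of_def
    by (auto intro!: measurable_resolved_state compatible_resolved_state elim!: eventually_mono)
  show "corresponds_to chi (resolved_state A \<nu>) \<nu>"
    unfolding corresponds_to_def
  proof (rule measure_eqI_countable[where A = UNIV])
    fix \<sigma>
    have "emeasure (distr (GW chi) (count_space UNIV) (resolved_state A \<nu>)) {\<sigma>}
        = emeasure (distr M (count_space UNIV) (resolved_state A \<nu> \<circ> T)) {\<sigma>}"
      unfolding distr_T[symmetric] by (subst distr_distr) (auto simp: measurable_resolved_state)
    also have "\<dots> = emeasure M {x \<in> space M. resolved_state A \<nu> (T x) = \<sigma>}"
      using measurable_comp[OF measurable_T measurable_resolved_state[of A \<nu>]]
      by (subst emeasure_distr) (auto intro!: arg_cong[where f = "emeasure M"])
    also have "\<dots> = emeasure M {x \<in> space M. \<omega> x [] = \<sigma>}"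
    proof (rule emeasure_eq_AE)
      show "AE x in M. x \<in> {x \<in> space M. resolved_state A \<nu> (T x) = \<sigma>} \<longleftrightarrow> x \<in> {x \<in> space M. \<omega> x [] = \<sigma>}"
        using assms by (auto simp: resolved_state_eq elim!: eventually_mono)
      show "{x \<in> space M. resolved_state A \<nu> (T x) = \<sigma>} \<in> sets M"
        using measurable_sets[OF measurable_comp[OF measurable_T measurable_resolved_state[of A \<nu>]], of "{\<sigma>}"]
        by (simp add: vimage_def Int_def conj_commute)
      show "{x \<in> space M. \<omega> x [] = \<sigma>} \<in> sets M"
        using sets_colour[of "[]" \<sigma>] by simp
    qed
    also have "\<dots> = emeasure (measure_pmf \<nu>) {\<sigma>}"
      by (simp add: emeasure_root_colour emeasure_pmf_single)
    finally show "emeasure (distr (GW chi) (count_space UNIV) (resolved_state A \<nu>)) {\<sigma>} = emeasure (measure_pmf \<nu>) {\<sigma>}" .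
  qed auto
qed

end

theorem theorem1p8:
  fixes A :: "('s::finite) automaton"
    and chi :: "nat pmf"
    and \<nu> :: "'s pmf"
    and M :: "'b measure"
    and T :: "'b \<Rightarrow> tree"
    and \<omega> :: "'b \<Rightarrow> nat list \<Rightarrow> 's"
  assumes "CARD('s) \<ge> 2"
    and "measure_pmf.prob chi {2..} > 0"
    and "distributional_map A chi \<nu> = \<nu>"
    and "\<forall>\<sigma>. pmf \<nu> \<sigma> \<noteq> 0"
    and "random_state_tree A chi \<nu> M T \<omega>"
    and "pivot_tree_subcritical A M T \<omega>"
  shows "\<exists>\<iota>. interpretation_of A chi \<iota> \<and> corresponds_to chi \<iota> \<nu>"
proof -
  interpret state_tree A chi \<nu> M T \<omega>
    by unfold_locales fact+
  obtain C r where C: "0 \<le> C" "0 \<le> r" "r < 1"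
    and decay: "\<And>n i. i \<in> types \<Longrightarrow> total_mean types means n i \<le> ennreal (C * r ^ n)"
    using total_mean_le_geometric[of types means] assms(6)
    by (auto simp: pivot_tree_subcritical_def)
  \<comment> \<open>With a single state the target set of the root would be empty; this is where
    \<open>CARD('s) \<ge> 2\<close> enters.\<close>
  have nontrivial: "- {a} \<noteq> {}" for a :: 's
  proof
    assume "- {a} = {}"
    then have "(UNIV :: 's set) = {a}" by auto
    with assms(1) show False
      by (metis card.empty card_insert_disjoint finite.emptyI empty_iff not_less_eq_eq numeral_2_eq_2 le_refl)
  qed
  have "mean_var n {a} \<le> ennreal (C * r ^ n)" for n a
  proof -
    have occ: "(a, - {a}) \<in> types"
      using assms(4) nontrivial by (intro root_type_occurs) auto
    have "mean_var n {a} = mean_var n (- {a})"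
      by (simp add: mean_var_Compl)
    \<comment> \<open>The complement of \<open>- {a}\<close> is \<open>{a}\<close>, so the weighted
      sum over types has a single term.\<close>
    also have "\<dots> \<le> ennreal (pmf \<nu> a) * total_mean types means n (a, - {a})"
      using mean_var_le_total_mean[of "- {a}" n] assms(4) nontrivial occ by simp
    also have "\<dots> \<le> 1 * ennreal (C * r ^ n)"
      by (intro mult_mono decay occ) (simp_all add: pmf_le_1)
    finally show ?thesis by simp
  qed
  then have "(\<Sum>n. mean_var n {a}) \<le> (\<Sum>n. ennreal (C * r ^ n))" for a
    by (intro suminf_le) auto
  also have "(\<Sum>n. ennreal (C * r ^ n)) < \<infinity>"
    using C by (subst suminf_ennreal2) (auto intro!: summable_mult summable_geometric)
  finally have "AE x in M. \<forall>a. \<omega> x [] = a \<longrightarrow> resolves A \<nu> (T x) a"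
    by (subst AE_all_countable) (auto intro!: AE_resolves)
  then have "AE x in M. resolves A \<nu> (T x) (\<omega> x [])"
    by (auto elim!: eventually_mono)
  then show ?thesis
    using interpretation_if_resolves by blast
qed

end
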